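(* Let $n\in\mathbb{N}$ and let $|\cdot|_a$ be a norm on $\mathbb{R}^n$ such that the unit sphere of $|\cdot|_a$ contains a point which is not an extremal point of the closed unit ball of $|\cdot|_a$. Let $X=([-1,1]^n,|\cdot|_a)$, let $m\ge n$ and let $|\cdot|_b$ be an arbitrary norm on $\mathbb{R}^m$. For $\Delta\ge 0$, the set \[\{f\in\textnormal{Lip}_1(X,(\mathbb{R}^m,|\cdot|_b)) : \mathcal{H}^n(f(X))>\Delta\}\] is residual in $\textnormal{Lip}_1(X,(\mathbb{R}^m,|\cdot|_b))$ if and only if $\Delta=0$.
   Context: $\textnormal{Lip}_1(X,Y)$ is the set of bounded $1$-Lipschitz maps $X\to Y$ with the supremum metric; a set is residual if it contains a countable intersection of open dense sets. $\mathcal{H}^n$ denotes the $n$-dimensional Hausdorff measure on $\mathbb{R}^m$ (with respect to the Euclidean distance). A point $u$ of a convex set $K$ is extremal if $u+v\in K$ and $u-v\in K$ imply $v=0$. *)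

theory Defs
  imports "HOL-Analysis.Analysis"
begin

definition is_norm :: "('a::real_vector \<Rightarrow> real) \<Rightarrow> bool" where
  "is_norm N \<longleftrightarrow> (\<forall>x. N x = 0 \<longleftrightarrow> x = 0) \<and> (\<forall>c x. N (c *\<^sub>R x) = \<bar>c\<bar> * N x)
     \<and> (\<forall>x y. N (x + y) \<le> N x + N y)"

definition extremal_point :: "'a::real_vector set \<Rightarrow> 'a \<Rightarrow> bool" where
  "extremal_point K u \<longleftrightarrow> u \<in> K \<and> (\<forall>v. u + v \<in> K \<and> u - v \<in> K \<longrightarrow> v = 0)"

definition norm_unit_ball :: "('a::real_vector \<Rightarrow> real) \<Rightarrow> 'a set" where
  "norm_unit_ball N = {x. N x \<le> 1}"

definition norm_unit_sphere :: "('a::real_vector \<Rightarrow> real) \<Rightarrow> 'a set" where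
  "norm_unit_sphere N = {x. N x = 1}"

definition cube :: "(real^'n) set" where
  "cube = {x. \<forall>i. \<bar>x $ i\<bar> \<le> 1}"

(* bounded 1-Lipschitz maps (X, dX) -> (Y, dY); maps are represented extensionally
   (value undefined-free: fixed to 0 outside X) so that equality of maps on X is equality *)
definition Lip1 :: "'a set \<Rightarrow> ('a \<Rightarrow> 'a \<Rightarrow> real) \<Rightarrow> ('b \<Rightarrow> 'b \<Rightarrow> real) \<Rightarrow> ('a \<Rightarrow> 'b::zero) set" where
  "Lip1 X dX dY = {f. (\<forall>x\<in>X. \<forall>y\<in>X. dY (f x) (f y) \<le> dX x y)
      \<and> (\<exists>B. \<forall>x\<in>X. \<forall>y\<in>X. dY (f x) (f y) \<le> B)
      \<and> (\<forall>x. x \<notin> X \<longrightarrow> f x = 0)}"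

definition sup_dist :: "'a set \<Rightarrow> ('b \<Rightarrow> 'b \<Rightarrow> real) \<Rightarrow> ('a \<Rightarrow> 'b) \<Rightarrow> ('a \<Rightarrow> 'b) \<Rightarrow> real" where
  "sup_dist X dY f g = (SUP x\<in>X. dY (f x) (g x))"

definition open_in_metric :: "'a set \<Rightarrow> ('a \<Rightarrow> 'a \<Rightarrow> real) \<Rightarrow> 'a set \<Rightarrow> bool" where
  "open_in_metric M d U \<longleftrightarrow> U \<subseteq> M \<and> (\<forall>f\<in>U. \<exists>e>0. \<forall>g\<in>M. d f g < e \<longrightarrow> g \<in> U)"

definition dense_in_metric :: "'a set \<Rightarrow> ('a \<Rightarrow> 'a \<Rightarrow> real) \<Rightarrow> 'a set \<Rightarrow> bool" where
  "dense_in_metric M d U \<longleftrightarrow> U \<subseteq> M \<and> (\<forall>f\<in>M. \<forall>e>0. \<exists>g\<in>U. d f g < e)"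

definition residual_in :: "'a set \<Rightarrow> ('a \<Rightarrow> 'a \<Rightarrow> real) \<Rightarrow> 'a set \<Rightarrow> bool" where
  "residual_in M d S \<longleftrightarrow> (\<exists>U :: nat \<Rightarrow> 'a set.
      (\<forall>k. open_in_metric M d (U k) \<and> dense_in_metric M d (U k)) \<and> M \<inter> (\<Inter>k. U k) \<subseteq> S)"

definition hausdorff_pre :: "nat \<Rightarrow> real \<Rightarrow> 'a::euclidean_space set \<Rightarrow> ennreal" where
  "hausdorff_pre s \<delta> A = (INF C \<in> {C :: nat \<Rightarrow> 'a set. A \<subseteq> (\<Union>i. C i)
        \<and> (\<forall>i. bounded (C i) \<and> diameter (C i) \<le> \<delta>)}.
      (\<Sum>i. ennreal (unit_ball_vol (real s) * (diameter (C i) / 2) ^ s)))"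

definition hausdorff_measure :: "nat \<Rightarrow> 'a::euclidean_space set \<Rightarrow> ennreal" where
  "hausdorff_measure s A = (SUP \<delta>\<in>{0<..}. hausdorff_pre s \<delta> A)"

end

theory Submission
  imports Defs
begin

text \<open>
  Positive measure is generic because it holds on a dense open set. Shrinking a map slightly,
  collapsing a small ball around the origin by a logarithmic cutoff and adding a small injective
  linear map yields a nearby 1-Lipschitz map that is affine and injective on a small ball. By
  Brouwer's fixed point theorem the image of every map close to it projects onto a set containing
  an \<open>n\<close>-dimensional ball.

  For \<open>\<Delta> > 0\<close> take \<open>u\<close> in the unit sphere of \<open>Na\<close> and \<open>v \<noteq> 0\<close> with \<open>u + v\<close> and \<open>u - v\<close> in the unit
  ball, a supporting functional \<open>\<phi>\<close> at \<open>u\<close>, and a point \<open>w\<close> of maximal Euclidean length in the unit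
  ball of \<open>Nb\<close>. A map close to \<open>f0 x = \<phi> x w\<close> must be nearly isometric in the direction \<open>u\<close> at most
  points and at every small scale. Since the points \<open>y + s r v\<close> with \<open>\<bar>r\<bar> \<le> 1\<close> all lie at distance at
  most \<open>s\<close> from both \<open>y - s u\<close> and \<open>y + s u\<close>, and \<open>w\<close> is extremal, the direction \<open>v\<close> is nearly
  collapsed there. So all maps near \<open>f0\<close> have images of measure at most \<open>\<Delta>\<close>, and Baire's theorem
  concludes.
\<close>


section \<open>Norms on Euclidean spaces\<close>

locale vector_norm =
  fixes N :: "'a::euclidean_space \<Rightarrow> real"
  assumes is_norm: "is_norm N"
begin

lemma eq_0_iff: "N x = 0 \<longleftrightarrow> x = 0"
  and scaleR: "N (c *\<^sub>R x) = \<bar>c\<bar> * N x"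
  and triangle: "N (x + y) \<le> N x + N y"
  using is_norm by (auto simp: is_norm_def)

lemma zero [simp]: "N 0 = 0"
  by (simp add: eq_0_iff)

lemma minus [simp]: "N (- x) = N x"
  using scaleR[of "-1" x] by simp

lemma nonneg [simp]: "0 \<le> N x"
  using triangle[of x "- x"] by simp

lemma pos_iff: "0 < N x \<longleftrightarrow> x \<noteq> 0"
  using nonneg[of x] eq_0_iff[of x] by linarith

lemma minus_commute: "N (x - y) = N (y - x)"
  using minus[of "x - y"] by simp

lemma triangle_diff: "N (x - z) \<le> N (x - y) + N (y - z)"
  using triangle[of "x - y" "y - z"] by simp

lemma reverse_triangle: "\<bar>N x - N y\<bar> \<le> N (x - y)"
  using triangle_diff[of x 0 y] triangle_diff[of y 0 x] minus_commute[of x y] by simp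

lemma sum_le: "N (\<Sum>i\<in>I. f i) \<le> (\<Sum>i\<in>I. N (f i))"
proof (induction I rule: infinite_finite_induct)
  case (insert i I)
  then show ?case using triangle[of "f i" "sum f I"] by simp
qed auto

lemma le_norm: obtains C where "C > 0" "\<And>x. N x \<le> C * norm x"
proof
  let ?C = "(\<Sum>b\<in>Basis. N b) + 1"
  show "?C > 0" by (simp add: add_nonneg_pos sum_nonneg)
  fix x
  have "N x = N (\<Sum>b\<in>Basis. (x \<bullet> b) *\<^sub>R b)" by (simp add: euclidean_representation)
  also have "\<dots> \<le> (\<Sum>b\<in>Basis. \<bar>x \<bullet> b\<bar> * N b)" by (rule order_trans[OF sum_le]) (simp add: scaleR)
  also have "\<dots> \<le> (\<Sum>b\<in>Basis. norm x * N b)" by (intro sum_mono mult_right_mono) (auto simp: Basis_le_norm)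
  also have "\<dots> \<le> ?C * norm x" by (simp add: sum_distrib_left algebra_simps)
  finally show "N x \<le> ?C * norm x" .
qed

lemma continuous_on_N: "continuous_on S N"
proof -
  obtain C where C: "C > 0" "\<And>x. N x \<le> C * norm x" using le_norm by blast
  have "C-lipschitz_on S N"
  proof (rule lipschitz_onI)
    show "dist (N x) (N y) \<le> C * dist x y" for x y
      using reverse_triangle[of x y] C(2)[of "x - y"] by (simp add: dist_norm)
  qed (use C in simp)
  then show ?thesis by (rule lipschitz_on_continuous_on)
qed

text \<open>\<open>N\<close> attains a positive minimum on the compact Euclidean unit sphere, and
  homogeneity carries this bound over to all vectors.\<close>

lemma norm_le: obtains C where "C > 0" "\<And>x. norm x \<le> C * N x"
proof -
  obtain b :: 'a where b: "b \<in> Basis" using nonempty_Basis by blast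
  have "compact (sphere (0::'a) 1)" "sphere (0::'a) 1 \<noteq> {}" using b by auto
  then obtain z where z: "z \<in> sphere 0 1" "\<And>y. y \<in> sphere 0 1 \<Longrightarrow> N z \<le> N y"
    using continuous_attains_inf[OF _ _ continuous_on_N] by metis
  then have Nz: "N z > 0" using pos_iff[of z] by auto
  have "norm x \<le> (1 / N z) * N x" for x
  proof (cases "x = 0")
    case False
    then have "N z \<le> N ((1 / norm x) *\<^sub>R x)" by (intro z) simp
    with False Nz show ?thesis by (simp add: scaleR field_simps)
  qed simp
  with Nz that[of "1 / N z"] show ?thesis by simp
qed

text \<open>Hahn-Banach in finite dimension: a hyperplane separating the open unit ball from
  \<open>u\<close>, rescaled to take the value 1 at \<open>u\<close>, is dominated by
  \<open>N\<close>.\<close>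

lemma support_functional:
  assumes "N u = 1"
  obtains a where "a \<bullet> u = 1" "\<And>x. \<bar>a \<bullet> x\<bar> \<le> N x"
proof -
  let ?S = "{x. N x < 1}"
  have "convex ?S"
  proof (rule convexI)
    fix x y and s t :: real
    assume *: "x \<in> ?S" "y \<in> ?S" "0 \<le> s" "0 \<le> t" "s + t = 1"
    have "N (s *\<^sub>R x + t *\<^sub>R y) \<le> s * N x + t * N y"
      using triangle[of "s *\<^sub>R x" "t *\<^sub>R y"] * by (simp add: scaleR)
    also have "\<dots> < 1"
      using convex_bound_lt[of "N x" 1 "N y" s t] * by simp
    finally show "s *\<^sub>R x + t *\<^sub>R y \<in> ?S" by simp
  qed
  moreover have "0 \<in> ?S" "?S \<inter> {u} = {}" using assms by auto
  ultimately obtain a b where a: "a \<noteq> 0" "\<And>x. N x < 1 \<Longrightarrow> a \<bullet> x \<le> b" "b \<le> a \<bullet> u"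
    using separating_hyperplane_sets[of ?S "{u}"] by (auto simp: inner_commute)
  have le: "a \<bullet> x \<le> N x * (a \<bullet> u)" for x
  proof (rule field_le_epsilon)
    fix e :: real assume "e > 0"
    \<comment> \<open>\<open>x / t\<close> lies in the open ball only for \<open>t > N x\<close>.
      The excess \<open>e / K\<close> is so small that it adds at most \<open>e\<close> to
      \<open>t * (a \<bullet> u)\<close>.\<close>
    define K where "K = \<bar>a \<bullet> u\<bar> + 1"
    define t where "t = N x + e / K"
    have K: "K > 0" and t: "t > N x" "t > 0" 
      using \<open>e > 0\<close> by (simp_all add: K_def t_def add_nonneg_pos)
    have "N ((1 / t) *\<^sub>R x) < 1" using t by (simp add: scaleR)
    then have "a \<bullet> ((1 / t) *\<^sub>R x) \<le> a \<bullet> u" using a(2,3) by (meson order_trans)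
    then have "a \<bullet> x \<le> t * (a \<bullet> u)" using t by (simp add: field_simps)
    also have "\<dots> = N x * (a \<bullet> u) + e * ((a \<bullet> u) / K)" by (simp add: t_def algebra_simps)
    also have "e * ((a \<bullet> u) / K) \<le> e * 1"
      using \<open>e > 0\<close> K by (intro mult_left_mono) (auto simp: K_def)
    finally show "a \<bullet> x \<le> N x * (a \<bullet> u) + e" by simp
  qed
  have "0 < a \<bullet> a" using a(1) by simp
  also have "\<dots> \<le> N a * (a \<bullet> u)" by (rule le)
  finally have au: "a \<bullet> u > 0" using nonneg[of a] by (simp add: zero_less_mult_iff)
  show ?thesis
  proof
    show "((1 / (a \<bullet> u)) *\<^sub>R a) \<bullet> u = 1" using au by simp
    fix x
    show "\<bar>((1 / (a \<bullet> u)) *\<^sub>R a) \<bullet> x\<bar> \<le> N x"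
      using le[of x] le[of "- x"] au by (simp add: field_simps abs_le_iff)
  qed
qed

text \<open>Compactness yields a longest vector \<open>w\<close> of the unit ball. The ball then
  lies inside a Euclidean ball whose sphere it touches at \<open>w\<close>, which brings Euclidean
  geometry to an arbitrary norm.\<close>

lemma max_norm_point:
  obtains w where "w \<noteq> 0" "N w \<le> 1" "\<And>x. norm x \<le> norm w * N x"
proof -
  obtain C where C: "C > 0" "\<And>x. norm x \<le> C * N x" using norm_le by blast
  let ?B = "{x. N x \<le> 1}"
  have "closed ?B" using continuous_on_N by (intro closed_Collect_le) auto
  moreover have "bounded ?B" unfolding bounded_iff
  proof (intro exI ballI)
    fix x assume "x \<in> ?B"
    then have "C * N x \<le> C * 1" using C(1) by (intro mult_left_mono) auto
    then show "norm x \<le> C" using C(2)[of x] by simp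
  qed
  ultimately have "compact ?B" by (simp add: compact_eq_bounded_closed)
  moreover have "0 \<in> ?B" by simp
  ultimately obtain w where w: "w \<in> ?B" "\<And>y. y \<in> ?B \<Longrightarrow> norm y \<le> norm w"
    using continuous_attains_sup[of ?B norm] continuous_on_norm_id by blast
  have le: "norm x \<le> norm w * N x" for x
  proof (cases "x = 0")
    case False
    then have "N x > 0" by (simp add: pos_iff)
    then have "norm ((1 / N x) *\<^sub>R x) \<le> norm w" by (intro w) (simp add: scaleR)
    with \<open>N x > 0\<close> show ?thesis by (simp add: field_simps)
  qed simp
  moreover obtain b :: 'a where b: "b \<in> Basis" using nonempty_Basis by blast
  with le[of b] have "w \<noteq> 0" by auto
  ultimately show ?thesis using w that by auto
qed

end

section \<open>Hausdorff measure\<close>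

abbreviation hausdorff_cost :: "nat \<Rightarrow> 'a::euclidean_space set \<Rightarrow> ennreal" where
  "hausdorff_cost s C \<equiv> ennreal (unit_ball_vol (real s) * (diameter C / 2) ^ s)"

lemma hausdorff_pre_le_seq:
  assumes "A \<subseteq> (\<Union>i. C i)" "\<And>i. bounded (C i)" "\<And>i. diameter (C i) \<le> \<delta>"
  shows "hausdorff_pre s \<delta> A \<le> (\<Sum>i. hausdorff_cost s (C i))"
  unfolding hausdorff_pre_def using assms by (intro INF_lower) auto

lemma hausdorff_pre_mono: "A \<subseteq> B \<Longrightarrow> hausdorff_pre s \<delta> A \<le> hausdorff_pre s \<delta> B"
  unfolding hausdorff_pre_def by (rule INF_superset_mono) auto

text \<open>Covers in the definition are indexed by all natural numbers. Indices that do not code an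
  element of \<open>I\<close> receive the empty set, which costs nothing because
  \<open>s > 0\<close>.\<close>

lemma hausdorff_pre_le_countable:
  assumes "countable I" "A \<subseteq> (\<Union>i\<in>I. C i)" "\<And>i. i \<in> I \<Longrightarrow> bounded (C i)"
    "\<And>i. i \<in> I \<Longrightarrow> diameter (C i) \<le> \<delta>" "\<delta> \<ge> 0" "s > 0"
  shows "hausdorff_pre s \<delta> A \<le> (\<integral>\<^sup>+i. hausdorff_cost s (C i) \<partial>count_space I)"
proof -
  define J where "J = to_nat_on I ` I"
  have bij: "bij_betw (to_nat_on I) I J"
    unfolding J_def using assms(1) by (intro inj_on_imp_bij_betw inj_on_to_nat_on)
  define D where "D k = (if k \<in> J then C (from_nat_into I k) else {})" for k
  have J: "from_nat_into I k \<in> I" if "k \<in> J" for k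
    using that assms(1) by (auto simp: J_def)
  have "hausdorff_pre s \<delta> A \<le> (\<Sum>k. hausdorff_cost s (D k))"
  proof (rule hausdorff_pre_le_seq)
    show "A \<subseteq> (\<Union>k. D k)"
    proof
      fix x assume "x \<in> A"
      then obtain i where "i \<in> I" "x \<in> C i" using assms(2) by blast
      then have "x \<in> D (to_nat_on I i)" using assms(1) by (simp add: D_def J_def)
      then show "x \<in> (\<Union>k. D k)" by blast
    qed
  qed (use assms J in \<open>auto simp: D_def\<close>)
  also have "\<dots> = (\<integral>\<^sup>+k. hausdorff_cost s (D k) \<partial>count_space UNIV)"
    by (simp add: nn_integral_count_space_nat)
  also have "\<dots> = (\<integral>\<^sup>+k. hausdorff_cost s (C (from_nat_into I k)) \<partial>count_space J)"
    using assms(6) by (subst nn_integral_count_space_indicator)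
      (auto intro!: nn_integral_cong simp: D_def indicator_def)
  also have "\<dots> = (\<integral>\<^sup>+i. hausdorff_cost s (C (from_nat_into I (to_nat_on I i))) \<partial>count_space I)"
    by (rule nn_integral_bij_count_space[OF bij, symmetric])
  also have "\<dots> = (\<integral>\<^sup>+i. hausdorff_cost s (C i) \<partial>count_space I)"
    using assms(1) by (intro nn_integral_cong) simp
  finally show ?thesis .
qed

text \<open>Passes from a bound for each single cover to the infimum over covers: a finite
  \<open>b\<close> can be subtracted, an infinite one makes the claim trivial.\<close>

lemma ennreal_le_add_INF:
  fixes a b :: ennreal
  assumes "\<And>i. i \<in> I \<Longrightarrow> a \<le> b + f i"
  shows "a \<le> b + (INF i\<in>I. f i)"
proof (cases "b = \<infinity>")
  case False
  then have "a - b \<le> f i" if "i \<in> I" for i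
    using assms[OF that] by (simp add: ennreal_minus_le_iff)
  then have "a - b \<le> (INF i\<in>I. f i)" by (rule INF_greatest)
  with False show ?thesis by (simp add: ennreal_minus_le_iff)
qed simp

text \<open>Covers of the two sets are interleaved along even and odd indices, and then the two
  infima are taken one after the other.\<close>

lemma hausdorff_pre_Un:
  "hausdorff_pre s \<delta> (A \<union> B) \<le> hausdorff_pre s \<delta> A + hausdorff_pre s \<delta> B"
proof -
  let ?\<C> = "\<lambda>A. {C :: nat \<Rightarrow> 'a set. A \<subseteq> (\<Union>i. C i) \<and> (\<forall>i. bounded (C i) \<and> diameter (C i) \<le> \<delta>)}"
  let ?c = "\<lambda>C. \<Sum>i. hausdorff_cost s (C i)"
  have *: "hausdorff_pre s \<delta> (A \<union> B) \<le> ?c C + ?c D" if "C \<in> ?\<C> A" "D \<in> ?\<C> B" for C D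
  proof -
    define E where "E i = (if even i then C (i div 2) else D (i div 2))" for i
    have "C i = E (2 * i)" "D i = E (Suc (2 * i))" for i by (auto simp: E_def)
    then have sub: "(\<Union>i. C i) \<union> (\<Union>i. D i) \<subseteq> (\<Union>i. E i)" by (metis SUP_upper UNIV_I UN_least Un_least)
    have "hausdorff_pre s \<delta> (A \<union> B) \<le> (\<Sum>i. hausdorff_cost s (E i))"
    proof (rule hausdorff_pre_le_seq)
      show "A \<union> B \<subseteq> (\<Union>i. E i)" using that sub by blast
    qed (use that in \<open>auto simp: E_def\<close>)
    also have "\<dots> \<le> ?c C + ?c D"
      unfolding suminf_eq_SUP[of "\<lambda>i. hausdorff_cost s (E i)"]
    proof (rule SUP_least)
      fix n :: nat
      have "(\<Sum>i<n. hausdorff_cost s (E i)) \<le> (\<Sum>i<2 * n. hausdorff_cost s (E i))"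
        by (intro sum_mono2) auto
      also have "\<dots> = (\<Sum>i<n. hausdorff_cost s (C i)) + (\<Sum>i<n. hausdorff_cost s (D i))"
        by (induction n) (simp_all add: E_def algebra_simps)
      also have "\<dots> \<le> ?c C + ?c D" by (intro add_mono sum_le_suminf) auto
      finally show "(\<Sum>i<n. hausdorff_cost s (E i)) \<le> ?c C + ?c D" .
    qed
    finally show ?thesis .
  qed
  have "hausdorff_pre s \<delta> (A \<union> B) \<le> ?c C + hausdorff_pre s \<delta> B" if "C \<in> ?\<C> A" for C
    unfolding hausdorff_pre_def[of s \<delta> B] using * that by (intro ennreal_le_add_INF)
  then have "hausdorff_pre s \<delta> (A \<union> B) \<le> hausdorff_pre s \<delta> B + hausdorff_pre s \<delta> A"
    unfolding hausdorff_pre_def[of s \<delta> A] by (intro ennreal_le_add_INF) (simp add: add.commute)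
  then show ?thesis by (simp add: add.commute)
qed

text \<open>The images of the covering sets under a linear map have Lebesgue outer measure
  comparable to their contribution to the Hausdorff measure.\<close>
lemma hausdorff_measure_pos_if_image_contains_ball:
  fixes P :: "'a::euclidean_space \<Rightarrow> 'b::euclidean_space"
  assumes "linear P" "cball z r \<subseteq> P ` S" "r > 0"
  shows "hausdorff_measure DIM('b) S > 0"
proof -
  obtain K where K: "K > 0" "\<And>x. norm (P x) \<le> K * norm x"
    using linear_bounded_pos[OF assms(1)] by blast
  let ?n = "DIM('b)"
  have "emeasure lborel (cball z r) \<le> ennreal ((2 * K) ^ ?n) * (\<Sum>i. hausdorff_cost ?n (C i))"
    if C: "S \<subseteq> (\<Union>i. C i)" "\<And>i. bounded (C i)" for C :: "nat \<Rightarrow> 'a set"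
  proof -
    \<comment> \<open>Any point of \<open>C i\<close> can serve as centre, since the other points
      are within one diameter of it. This radius, set against the half diameter in the cost,
      produces the factor \<open>(2 * K) ^ ?n\<close>.\<close>
    define D where "D i = (if C i = {} then {} else cball (P (SOME x. x \<in> C i)) (K * diameter (C i)))" for i
    have sub: "P ` C i \<subseteq> D i" for i
    proof (clarify)
      fix x assume x: "x \<in> C i"
      define y where "y = (SOME x. x \<in> C i)"
      have y: "y \<in> C i" using x unfolding y_def by (rule someI)
      have "norm (P y - P x) \<le> K * norm (y - x)" using K(2)[of "y - x"] linear_diff[OF assms(1)] by metis
      also have "\<dots> \<le> K * diameter (C i)"
        using diameter_bounded_bound[OF C(2) y x] K by (simp add: dist_norm)
      finally show "P x \<in> D i" using x by (auto simp: D_def y_def dist_norm)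
    qed
    have meas: "emeasure lborel (D i) \<le> ennreal ((2 * K) ^ ?n) * hausdorff_cost ?n (C i)" for i
    proof (cases "C i = {}")
      case False
      have d: "0 \<le> diameter (C i)" using C(2) by (rule diameter_ge_0)
      have "emeasure lborel (D i) = ennreal (unit_ball_vol ?n * (K * diameter (C i)) ^ ?n)"
        using False d K by (simp add: D_def emeasure_cball)
      also have "\<dots> = ennreal ((2 * K) ^ ?n) * hausdorff_cost ?n (C i)"
        using d K by (subst ennreal_mult[symmetric]) (auto simp: power_mult_distrib power_divide)
      finally show ?thesis by simp
    qed (simp add: D_def)
    have sets: "D i \<in> sets lborel" for i by (simp add: D_def)
    have "cball z r \<subseteq> (\<Union>i. D i)"
    proof
      fix y assume "y \<in> cball z r"
      then obtain x where "x \<in> S" "y = P x" using assms(2) by blast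
      moreover obtain i where "x \<in> C i" using C(1) \<open>x \<in> S\<close> by blast
      ultimately show "y \<in> (\<Union>i. D i)" using sub by blast
    qed
    then have "emeasure lborel (cball z r) \<le> emeasure lborel (\<Union>i. D i)"
      by (rule emeasure_mono) (rule sets.countable_UN, use sets in blast)
    also have "\<dots> \<le> (\<Sum>i. emeasure lborel (D i))"
      by (rule emeasure_subadditive_countably) (use sets in blast)
    also have "\<dots> \<le> (\<Sum>i. ennreal ((2 * K) ^ ?n) * hausdorff_cost ?n (C i))"
      by (rule suminf_le[OF meas]) auto
    also have "\<dots> = ennreal ((2 * K) ^ ?n) * (\<Sum>i. hausdorff_cost ?n (C i))"
      by (rule ennreal_suminf_cmult)
    finally show ?thesis .
  qed
  note cover = this
  have "emeasure lborel (cball z r) = ennreal (unit_ball_vol ?n * r ^ ?n)"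
    using assms(3) by (simp add: emeasure_cball)
  then have pos: "emeasure lborel (cball z r) > 0"
    using assms(3) by (simp add: unit_ball_vol_pos)
  \<comment> \<open>One fixed scale suffices for a lower bound, as the Hausdorff measure is the
    supremum over all scales.\<close>
  have "emeasure lborel (cball z r) / ennreal ((2 * K) ^ ?n) \<le> hausdorff_pre ?n 1 S"
    unfolding hausdorff_pre_def
  proof (rule INF_greatest, clarify)
    fix C :: "nat \<Rightarrow> 'a set" assume "S \<subseteq> (\<Union>i. C i)" "\<forall>i. bounded (C i) \<and> diameter (C i) \<le> 1"
    then have "emeasure lborel (cball z r) \<le> ennreal ((2 * K) ^ ?n) * (\<Sum>i. hausdorff_cost ?n (C i))"
      by (intro cover) auto
    then show "emeasure lborel (cball z r) / ennreal ((2 * K) ^ ?n) \<le> (\<Sum>i. hausdorff_cost ?n (C i))"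
      using K by (intro divide_le_posI_ennreal) (auto simp: mult.commute)
  qed
  moreover have "0 < emeasure lborel (cball z r) / ennreal ((2 * K) ^ ?n)"
    using pos K by (auto simp: ennreal_zero_less_divide)
  moreover have "hausdorff_pre ?n 1 S \<le> hausdorff_measure ?n S"
    unfolding hausdorff_measure_def by (rule SUP_upper) simp
  ultimately show ?thesis by (meson less_le_trans)
qed


text \<open>\<open>E\<close> is approximated from outside by an open set \<open>T\<close> and
  covered by small nonoverlapping cubes inside \<open>T\<close>. A cube of side \<sigma> has
  diameter at most \<open>?n * \<sigma>\<close>, so the cost of its image is at most a constant
  times its volume, and the constant does not depend on \<delta>.\<close>

lemma hausdorff_pre_lipschitz_image_le:
  fixes f :: "'a::euclidean_space \<Rightarrow> 'b::euclidean_space"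
  assumes "E \<in> lmeasurable" "bounded E" "L \<ge> 0" "\<delta> > 0"
    and lip: "\<And>x y. x \<in> E \<Longrightarrow> y \<in> E \<Longrightarrow> norm (f x - f y) \<le> L * norm (x - y)"
  shows "hausdorff_pre DIM('a) \<delta> (f ` E)
    \<le> ennreal (unit_ball_vol DIM('a) * (L * DIM('a) / 2) ^ DIM('a) * measure lebesgue E)"
proof -
  let ?n = "DIM('a)"
  define A where "A = unit_ball_vol ?n * (L * ?n / 2) ^ ?n"
  have A: "A \<ge> 0" using assms(3) by (simp add: A_def)
  have main: "hausdorff_pre ?n \<delta> (f ` E) \<le> ennreal (A * measure lebesgue T)"
    if T: "open T" "E \<subseteq> T" "T \<in> lmeasurable" for T
  proof -
    define d where "d = \<delta> / (2 * (L + 1))"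
    have d: "d > 0" using assms(3,4) by (simp add: d_def)
    have Ld: "L * (2 * d) \<le> \<delta>" using assms(3,4) by (simp add: d_def field_simps)
    \<comment> \<open>The gauge forces a cube tagged by a point of \<open>E\<close> to lie in
      \<open>T\<close> and to have an image of diameter at most \<delta>. The second branch only
      makes it a gauge at the points outside \<open>T\<close>.\<close>
    define g where "g x = (if x \<in> T then T \<inter> ball x d else ball x d)" for x
    have gauge: "gauge g" unfolding gauge_def g_def using T(1) d by auto
    obtain B where B: "\<And>x. x \<in> E \<Longrightarrow> norm x \<le> B" using assms(2) bounded_iff by metis
    define c where "c = \<bar>B\<bar> + 1"
    have c: "c > 0" by (simp add: c_def)
    let ?a = "(- c) *\<^sub>R (One :: 'a)" and ?b = "c *\<^sub>R (One :: 'a)"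
    have "E \<subseteq> cbox ?a ?b"
    proof
      fix x assume "x \<in> E"
      then have "\<bar>x \<bullet> i\<bar> \<le> c" if "i \<in> Basis" for i
        using B[of x] Basis_le_norm[OF that, of x] by (simp add: c_def)
      then show "x \<in> cbox ?a ?b" by (force simp: mem_box abs_le_iff)
    qed
    moreover have "box ?a ?b \<noteq> {}" using c by (simp add: box_ne_empty)
    ultimately obtain \<D> where \<D>: "countable \<D>"
      "\<And>K. K \<in> \<D> \<Longrightarrow> interior K \<noteq> {} \<and> (\<exists>c d. K = cbox c d)"
      "pairwise (\<lambda>A B. interior A \<inter> interior B = {}) \<D>"
      "\<And>K. K \<in> \<D> \<Longrightarrow> \<exists>x \<in> E \<inter> K. K \<subseteq> g x"
      "\<And>u v. cbox u v \<in> \<D> \<Longrightarrow> \<exists>n. \<forall>i \<in> Basis. v \<bullet> i - u \<bullet> i = (?b \<bullet> i - ?a \<bullet> i) / 2^n"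
      "E \<subseteq> \<Union>\<D>"
      using covering_lemma[of E ?a ?b g] gauge by metis
    let ?C = "\<lambda>K. f ` (K \<inter> E)"
    have K: "bounded (?C K) \<and> diameter (?C K) \<le> \<delta> \<and> K \<subseteq> T \<and>
        hausdorff_cost ?n (?C K) \<le> ennreal A * emeasure lebesgue (interior K)" if "K \<in> \<D>" for K
    proof -
      obtain x where x: "x \<in> E" "x \<in> K" "K \<subseteq> T \<inter> ball x d"
        using \<D>(4)[OF \<open>K \<in> \<D>\<close>] T(2) by (auto simp: g_def)
      obtain p q where pq: "K = cbox p q" using \<D>(2)[OF \<open>K \<in> \<D>\<close>] by blast
      with \<D>(5) \<open>K \<in> \<D>\<close> obtain k where k: "\<forall>i \<in> Basis. q \<bullet> i - p \<bullet> i = (?b \<bullet> i - ?a \<bullet> i) / 2^k" by metis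
      define \<sigma> where "\<sigma> = 2 * c / 2 ^ k"
      have \<sigma>: "\<sigma> > 0" "\<And>i. i \<in> Basis \<Longrightarrow> q \<bullet> i - p \<bullet> i = \<sigma>" using k c by (auto simp: \<sigma>_def)
      have le\<delta>: "norm (f y - f z) \<le> \<delta>" if "y \<in> K \<inter> E" "z \<in> K \<inter> E" for y z
      proof -
        have "dist y x < d" "dist x z < d" using that x by (auto simp: dist_commute)
        then have "norm (y - z) \<le> 2 * d" using dist_triangle[of y z x] by (simp add: dist_norm)
        then have "L * norm (y - z) \<le> L * (2 * d)" using assms(3) by (rule mult_left_mono)
        then show ?thesis using lip[of y z] that Ld by auto
      qed
      then have bdd: "bounded (?C K)"
        unfolding bounded_def using x by (auto simp: dist_norm intro!: exI[of _ "f x"] exI[of _ \<delta>])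
      have diam: "diameter (?C K) \<le> \<delta>" using le\<delta> assms(4) by (intro diameter_le) auto
      have "diameter (?C K) \<le> L * (?n * \<sigma>)"
      proof (rule diameter_le)
        fix a b assume "a \<in> ?C K" "b \<in> ?C K"
        then obtain y z where yz: "y \<in> K \<inter> E" "z \<in> K \<inter> E" "a = f y" "b = f z" by auto
        have "norm (y - z) \<le> (\<Sum>i\<in>Basis. \<bar>(y - z) \<bullet> i\<bar>)" by (rule norm_le_l1)
        also have "\<dots> \<le> (\<Sum>i\<in>(Basis::'a set). \<sigma>)"
        proof (rule sum_mono)
          fix i :: 'a assume i: "i \<in> Basis"
          with yz pq have "p \<bullet> i \<le> y \<bullet> i" "y \<bullet> i \<le> q \<bullet> i" "p \<bullet> i \<le> z \<bullet> i" "z \<bullet> i \<le> q \<bullet> i"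
            by (auto simp: mem_box)
          with \<sigma>(2)[OF i] show "\<bar>(y - z) \<bullet> i\<bar> \<le> \<sigma>" by (simp add: inner_diff_left)
        qed
        finally have "L * norm (y - z) \<le> L * (?n * \<sigma>)" using assms(3) by (intro mult_left_mono) auto
        then show "norm (a - b) \<le> L * (?n * \<sigma>)" using lip[of y z] yz by auto
      qed (use assms \<sigma> in auto)
      then have "hausdorff_cost ?n (?C K) \<le> ennreal (unit_ball_vol ?n * (L * (?n * \<sigma>) / 2) ^ ?n)"
        using bdd by (intro ennreal_leI mult_left_mono power_mono divide_right_mono)
          (auto intro: diameter_ge_0)
      also have "\<dots> = ennreal (A * \<sigma> ^ ?n)"
        by (simp add: A_def power_mult_distrib power_divide mult.assoc)
      also have "\<dots> = ennreal A * emeasure lebesgue (interior K)"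
      proof -
        have "emeasure lborel (box p q) = ennreal (\<Prod>i\<in>Basis. (q - p) \<bullet> i)"
          using \<sigma> by (subst emeasure_lborel_box) (smt (verit) , simp)
        also have "(\<Prod>i\<in>Basis. (q - p) \<bullet> i) = \<sigma> ^ ?n" using \<sigma> by (simp add: inner_diff_left)
        finally show ?thesis using A \<sigma> pq by (simp add: ennreal_mult interior_cbox)
      qed
      finally show ?thesis using bdd diam x(3) by blast
    qed
    have "hausdorff_pre ?n \<delta> (f ` E) \<le> (\<integral>\<^sup>+K. hausdorff_cost ?n (?C K) \<partial>count_space \<D>)"
    proof (rule hausdorff_pre_le_countable)
      show "f ` E \<subseteq> (\<Union>K\<in>\<D>. ?C K)" using \<D>(6) by blast
    qed (use \<D>(1) K assms(4) in auto)
    also have "\<dots> \<le> (\<integral>\<^sup>+K. ennreal A * emeasure lebesgue (interior K) \<partial>count_space \<D>)"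
      using K by (intro nn_integral_mono) auto
    also have "\<dots> = ennreal A * (\<integral>\<^sup>+K. emeasure lebesgue (interior K) \<partial>count_space \<D>)"
      by (rule nn_integral_cmult) simp
    \<comment> \<open>Neighbouring cubes may share faces; their disjoint interiors carry the same
      volume and can be summed.\<close>
    also have "(\<integral>\<^sup>+K. emeasure lebesgue (interior K) \<partial>count_space \<D>) = emeasure lebesgue (\<Union>K\<in>\<D>. interior K)"
      using \<D>(1,3) by (intro emeasure_UN_countable[symmetric])
        (auto simp: disjoint_family_on_def pairwise_def)
    also have "\<dots> \<le> emeasure lebesgue T"
      using T K interior_subset by (intro emeasure_mono) (blast, auto)
    also have "\<dots> = ennreal (measure lebesgue T)" using T(3) by (simp add: emeasure_eq_measure2)
    finally show ?thesis using A by (simp add: ennreal_mult mult_left_mono)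
  qed
  have "hausdorff_pre ?n \<delta> (f ` E) \<le> ennreal (A * measure lebesgue E)"
  proof (rule ennreal_le_epsilon)
    fix e :: real assume "e > 0"
    define e' where "e' = e / (A + 1)"
    have e': "e' > 0" "A * e' \<le> e" using A \<open>e > 0\<close> by (auto simp: e'_def field_simps)
    obtain T where T: "open T" "E \<subseteq> T" "T - E \<in> lmeasurable" "emeasure lebesgue (T - E) < ennreal e'"
      using sets_lebesgue_outer_open[OF fmeasurableD[OF assms(1)] e'(1)] by metis
    have T_eq: "T = E \<union> (T - E)" using T(2) by auto
    then have "T \<in> lmeasurable" using assms(1) T(3) by (metis fmeasurable.Un)
    moreover have "measure lebesgue (T - E) < e'"
      using T(3,4) e'(1) by (simp add: emeasure_eq_measure2 ennreal_less_iff)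
    then have mT: "measure lebesgue T \<le> measure lebesgue E + e'"
      using measure_Un_le[of E lebesgue "T - E"] assms(1) T(3) T_eq by (metis add_left_mono fmeasurableD less_imp_le order_trans)
    ultimately    have "hausdorff_pre ?n \<delta> (f ` E) \<le> ennreal (A * measure lebesgue T)" using main T(1,2) by blast
    also have "A * measure lebesgue T \<le> A * (measure lebesgue E + e')"
      using mT A by (intro mult_left_mono) auto
    also have "\<dots> \<le> A * measure lebesgue E + e" using e'(2) by (simp add: algebra_simps)
    finally show "hausdorff_pre ?n \<delta> (f ` E) \<le> ennreal (A * measure lebesgue E) + ennreal e"
      using A \<open>e > 0\<close> by (simp add: ennreal_leI ennreal_plus[symmetric] del: ennreal_plus)
  qed
  then show ?thesis by (simp add: A_def)
qed

section \<open>Concentric cubes\<close>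

abbreviation ccube :: "real \<Rightarrow> (real^'n) set" where
  "ccube l \<equiv> cbox (\<chi> i. - l) (\<chi> i. l)"

lemma mem_ccube: "x \<in> ccube l \<longleftrightarrow> (\<forall>i. \<bar>x $ i\<bar> \<le> l)"
  by (simp add: mem_box_cart abs_le_iff) (metis minus_le_iff)

lemma cube_eq_ccube: "cube = ccube 1"
  by (auto simp: cube_def mem_ccube)

lemma ccube_add:
  assumes "x \<in> ccube l" "norm c \<le> t" "l + t \<le> l'"
  shows "x + c \<in> ccube l'"
proof -
  have "\<bar>x $ i\<bar> \<le> l" "\<bar>c $ i\<bar> \<le> norm c" for i
    using assms by (auto simp: mem_ccube component_le_norm_cart)
  then have "\<bar>x $ i + c $ i\<bar> \<le> l'" for i
    using assms(2,3) abs_triangle_ineq[of "x $ i" "c $ i"] by (meson add_mono order_trans)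
  then show ?thesis by (simp add: mem_ccube)
qed

lemma measure_ccube:
  assumes "l \<ge> 0"
  shows "measure lebesgue (ccube l :: (real^'n) set) = (2 * l) ^ CARD('n)"
proof -
  have "ccube l \<noteq> ({} :: (real^'n) set)" using assms by (simp add: interval_ne_empty_cart)
  then show ?thesis by (simp add: content_cbox_cart)
qed

lemma power_diff_le_mult:
  fixes a b :: real
  assumes "0 \<le> a" "a \<le> b" "b \<le> 1"
  shows "b ^ k - a ^ k \<le> k * (b - a)"
proof (induction k)
  case (Suc k)
  have "b ^ Suc k - a ^ Suc k = b * (b ^ k - a ^ k) + (b - a) * a ^ k" by (simp add: algebra_simps)
  also have "b * (b ^ k - a ^ k) \<le> 1 * (b ^ k - a ^ k)"
    using assms by (intro mult_right_mono) (auto simp: power_mono)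
  also have "(b - a) * a ^ k \<le> (b - a) * 1"
    using assms by (intro mult_left_mono power_le_one) auto
  finally show ?case using Suc by (simp add: algebra_simps)
qed simp

lemma measure_ccube_diff_le:
  fixes l t :: real
  assumes "0 \<le> t" "t \<le> l" "l \<le> 1"
  shows "measure lebesgue (ccube l :: (real^'n) set) - measure lebesgue (ccube (l - t) :: (real^'n) set)
    \<le> 2 ^ CARD('n) * real CARD('n) * t"
proof -
  have "l ^ CARD('n) - (l - t) ^ CARD('n) \<le> CARD('n) * (l - (l - t))"
    using assms by (intro power_diff_le_mult) auto
  then have "2 ^ CARD('n) * (l ^ CARD('n) - (l - t) ^ CARD('n)) \<le> 2 ^ CARD('n) * (CARD('n) * t)"
    by (intro mult_left_mono) auto
  moreover have "measure lebesgue (ccube l :: (real^'n) set) = 2 ^ CARD('n) * l ^ CARD('n)"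
    "measure lebesgue (ccube (l - t) :: (real^'n) set) = 2 ^ CARD('n) * (l - t) ^ CARD('n)"
    using measure_ccube[of l, where 'n='n] measure_ccube[of "l - t", where 'n='n] assms
    by (simp_all only: power_mult_distrib)
  ultimately show ?thesis by (simp only: right_diff_distrib mult.assoc)
qed

text \<open>The translated cube contains the concentric cube shrunk by \<open>norm c\<close>. Both
  \<open>h + \<epsilon>\<close> and \<open>\<epsilon> - h\<close> are nonnegative, so monotonicity
  of their integrals under inclusion bounds the difference from both sides by \<epsilon> times the
  volume of a thin layer.\<close>

lemma integral_translate_ccube:
  fixes h :: "real^'n \<Rightarrow> real"
  assumes "continuous_on (ccube 1) h" "\<And>x. x \<in> ccube 1 \<Longrightarrow> \<bar>h x\<bar> \<le> \<epsilon>"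
    "norm c \<le> l" "l + norm c \<le> 1"
  shows "\<bar>integral (ccube l) (\<lambda>y. h (y + c)) - integral (ccube (l - norm c)) h\<bar>
    \<le> \<epsilon> * (2 ^ CARD('n) * real CARD('n) * norm c)"
proof -
  let ?S = "cbox ((\<chi> i. - l) + c) ((\<chi> i. l) + c)" and ?Q = "ccube (l - norm c) :: (real^'n) set"
  have S_eq: "?S = (+) c ` ccube l" by (simp add: cbox_translation add.commute)
  have "0 \<le> \<epsilon>" using assms(2)[of 0] by (auto simp: mem_ccube)
  have "?S \<subseteq> ccube 1" unfolding S_eq using ccube_add[of _ l c "norm c" 1] assms(4) by (auto simp: add.commute)
  have "?Q \<subseteq> ?S"
  proof
    fix x assume "x \<in> ?Q"
    then have "x + (- c) \<in> ccube l" by (rule ccube_add[of _ _ _ "norm c"]) auto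
    then show "x \<in> ?S" unfolding S_eq by (intro image_eqI[of _ _ "x + (- c)"]) auto
  qed
  have bnd: "0 \<le> h x + \<epsilon>" "h x \<le> \<epsilon>" if "x \<in> ?S" for x
    using assms(2)[of x] that \<open>?S \<subseteq> ccube 1\<close> by (auto simp: abs_le_iff)
  have intS: "h integrable_on ?S" and intQ: "h integrable_on ?Q"
    using \<open>?S \<subseteq> ccube 1\<close> \<open>?Q \<subseteq> ?S\<close> assms(1)
    by (auto intro!: integrable_continuous intro: continuous_on_subset)
  have "((\<lambda>y. h (1 *\<^sub>R y + c)) has_integral (integral ?S h /\<^sub>R 1 ^ DIM(real^'n)))
      (cbox (((\<chi> i. - l) + c - c) /\<^sub>R 1) (((\<chi> i. l) + c - c) /\<^sub>R 1))"
    by (rule has_integral_affinity') (use intS in auto)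
  then have shift: "integral (ccube l) (\<lambda>y. h (y + c)) = integral ?S h"
    by (simp add: integral_unique)
  have aff: "integral (cbox a b) (\<lambda>x. h x + \<epsilon>) = integral (cbox a b) h + measure lebesgue (cbox a b) * \<epsilon>"
    "integral (cbox a b) (\<lambda>x. \<epsilon> - h x) = measure lebesgue (cbox a b) * \<epsilon> - integral (cbox a b) h"
    if "h integrable_on cbox a b" for a b
    using has_integral_add[OF integrable_integral[OF that] has_integral_const[of \<epsilon> a b]]
      has_integral_diff[OF has_integral_const[of \<epsilon> a b] integrable_integral[OF that]]
    by (auto simp: integral_unique)
  have "integral ?Q (\<lambda>x. h x + \<epsilon>) \<le> integral ?S (\<lambda>x. h x + \<epsilon>)"
    "integral ?Q (\<lambda>x. \<epsilon> - h x) \<le> integral ?S (\<lambda>x. \<epsilon> - h x)"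
    using \<open>?Q \<subseteq> ?S\<close> intS intQ bnd
    by (auto intro!: integral_subset_le integrable_add integrable_diff)
  moreover have "integral ?Q (\<lambda>x. h x + \<epsilon>) = integral ?Q h + measure lebesgue ?Q * \<epsilon>"
    "integral ?Q (\<lambda>x. \<epsilon> - h x) = measure lebesgue ?Q * \<epsilon> - integral ?Q h"
    "integral ?S (\<lambda>x. h x + \<epsilon>) = integral ?S h + measure lebesgue ?S * \<epsilon>"
    "integral ?S (\<lambda>x. \<epsilon> - h x) = measure lebesgue ?S * \<epsilon> - integral ?S h"
    using aff[OF intS] aff[OF intQ] by auto
  moreover have "measure lebesgue ?S * \<epsilon> = measure lebesgue (ccube l :: (real^'n) set) * \<epsilon>"
    unfolding S_eq by (simp only: measure_translation)
  moreover have "\<epsilon> * (measure lebesgue (ccube l :: (real^'n) set) - measure lebesgue ?Q)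
      \<le> \<epsilon> * (2 ^ CARD('n) * real CARD('n) * norm c)"
    using assms(3,4) norm_ge_zero[of c] \<open>0 \<le> \<epsilon>\<close>
    by (intro mult_left_mono measure_ccube_diff_le) (auto simp del: norm_ge_zero)
  ultimately show ?thesis unfolding shift abs_le_iff right_diff_distrib mult.commute[of _ \<epsilon>]
    by (intro conjI) linarith+
qed

text \<open>Markov's inequality for a difference of translates of the same function: its integral is only
  of the order of the translation length, since most of the two integrals cancels.\<close>
lemma measure_translate_diff_le:
  fixes h :: "real^'n \<Rightarrow> real"
  assumes "continuous_on (ccube 1) h" "\<And>x. x \<in> ccube 1 \<Longrightarrow> \<bar>h x\<bar> \<le> \<epsilon>"
    "norm c \<le> l" "l + norm c \<le> 1" "m > 0"
    and nonneg: "\<And>y. y \<in> ccube l \<Longrightarrow> h (y + c) \<le> h (y - c)"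
  defines "E \<equiv> {y \<in> ccube l. m < h (y - c) - h (y + c)}"
  shows "E \<in> lmeasurable"
    and "m * measure lebesgue E \<le> 2 * \<epsilon> * (2 ^ CARD('n) * real CARD('n) * norm c)"
proof -
  let ?g = "\<lambda>y. h (y - c) - h (y + c)" and ?Q = "ccube l :: (real^'n) set"
  have "(\<lambda>y. y + c) ` ?Q \<subseteq> ccube 1" "(\<lambda>y. y - c) ` ?Q \<subseteq> ccube 1"
    using ccube_add[of _ l c "norm c" 1] ccube_add[of _ l "- c" "norm c" 1] assms(4) by auto
  then have cont: "continuous_on ?Q (\<lambda>y. h (y + c))" "continuous_on ?Q (\<lambda>y. h (y - c))"
    by (auto intro!: continuous_on_compose2[OF assms(1)] continuous_intros)
  have "closed (?Q \<inter> ?g -` {..m})"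
    using cont by (intro continuous_closed_preimage continuous_intros) auto
  then have "?Q \<inter> ?g -` {..m} \<in> lmeasurable"
    by (intro bounded_set_imp_lmeasurable) (auto intro: bounded_subset[OF bounded_cbox] lebesgue_closedin)
  moreover have "E = ?Q - (?Q \<inter> ?g -` {..m})" by (auto simp: E_def)
  ultimately show E: "E \<in> lmeasurable" by (simp add: fmeasurable.Diff)
  have "E \<subseteq> ?Q" by (auto simp: E_def)
  then have "m * measure lebesgue E = integral ?Q (\<lambda>y. m * indicator E y)"
    using E by (simp add: integral_indicator Int_absorb2)
  also have "\<dots> \<le> integral ?Q ?g"
  proof (rule integral_le)
    show "(\<lambda>y. m * indicat_real E y) integrable_on ?Q"
      using E \<open>E \<subseteq> ?Q\<close> by (intro integrable_on_mult_right) (simp add: integrable_on_indicator Int_absorb2)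
    show "?g integrable_on ?Q" using cont by (intro integrable_continuous continuous_intros)
    show "m * indicat_real E y \<le> ?g y" if "y \<in> ?Q" for y
      using nonneg[OF that] that by (auto simp: E_def indicator_def)
  qed
  also have "\<dots> = integral ?Q (\<lambda>y. h (y + (- c))) - integral ?Q (\<lambda>y. h (y + c))"
    using cont by (simp add: integral_diff integrable_continuous)
  \<comment> \<open>The translates by \<open>c\<close> and by \<open>- c\<close> are both compared
    with the same smaller cube, whence the factor 2.\<close>
  also have "\<dots> \<le> 2 * \<epsilon> * (2 ^ CARD('n) * real CARD('n) * norm c)"
    using integral_translate_ccube[OF assms(1,2), of c l] integral_translate_ccube[OF assms(1,2), of "- c" l] assms(3,4)
    by simp
  finally show "m * measure lebesgue E \<le> 2 * \<epsilon> * (2 ^ CARD('n) * real CARD('n) * norm c)" .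
qed


section \<open>Covering the image along a collapsed direction\<close>

lemma card_floor_interval_le:
  fixes X :: real
  assumes "X \<ge> 1"
  shows "real (card {\<lfloor>- X\<rfloor>..\<lfloor>X\<rfloor>}) \<le> 4 * X"
proof -
  have "\<lfloor>- X\<rfloor> \<le> \<lfloor>X\<rfloor>" using assms by (intro floor_mono) simp
  then have "real (card {\<lfloor>- X\<rfloor>..\<lfloor>X\<rfloor>}) = real_of_int \<lfloor>X\<rfloor> - real_of_int \<lfloor>- X\<rfloor> + 1"
    by simp
  also have "\<dots> \<le> 4 * X" using assms of_int_floor_le[of X] floor_correct[of "- X"] by linarith
  finally show ?thesis .
qed

text \<open>The pieces are boxes of length \<open>s\<close> in the direction \<open>v\<close>, in which \<open>f\<close> hardly moves,
  and of length \<open>\<theta> s\<close> in the other directions.\<close>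
lemma hausdorff_pre_collapsed_direction_le:
  fixes f :: "real^'n \<Rightarrow> 'b::euclidean_space"
    and s \<theta> L W \<delta> :: real
  assumes "G \<subseteq> ccube 1" "v $ j \<noteq> 0" "0 < s" "s \<le> 1" "s * norm v \<le> 1" "0 < \<theta>" "\<theta> \<le> 1"
    "L \<ge> 0" "W \<ge> 0" "(W + L * CARD('n)) * (\<theta> * s) \<le> \<delta>"
    and lip: "\<And>x y. x \<in> ccube 1 \<Longrightarrow> y \<in> ccube 1 \<Longrightarrow> norm (f x - f y) \<le> L * norm (x - y)"
    and mem: "\<And>y r. y \<in> G \<Longrightarrow> \<bar>r\<bar> \<le> 1 \<Longrightarrow> y + (s * r) *\<^sub>R v \<in> ccube 1"
    and collapse: "\<And>y r. y \<in> G \<Longrightarrow> \<bar>r\<bar> \<le> 1 \<Longrightarrow> norm (f (y + (s * r) *\<^sub>R v) - f y) \<le> W * (\<theta> * s)"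
  shows "hausdorff_pre CARD('n) \<delta> (f ` G) \<le>
    ennreal (4 / \<bar>v $ j\<bar> * 8 ^ (CARD('n) - 1) * unit_ball_vol CARD('n) * ((W + L * CARD('n)) / 2) ^ CARD('n) * \<theta>)"
proof -
  let ?n = "CARD('n)"
  \<comment> \<open>Each \<open>y\<close> is slid along \<open>v\<close> to the point
    \<open>z y\<close>, whose coordinate \<open>j\<close> is an integer multiple of
    \<open>s * v $ j\<close>; the slide has length \<open>t y\<close> in units of
    \<open>s *\<^sub>R v\<close>, with \<open>t y\<close> in [0, 1).\<close>
  define k where "k y = \<lfloor>y $ j / (s * v $ j)\<rfloor>" for y
  define t where "t y = y $ j / (s * v $ j) - k y" for y
  define z where "z y = y - (s * t y) *\<^sub>R v" for y
  define \<tau> where "\<tau> = \<theta> * s"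
  \<comment> \<open>A piece is named by its layer number in coordinate \<open>j\<close> and by the
    grid cells of side \<tau> that contain the other coordinates of \<open>z y\<close>.\<close>
  define \<iota> where "\<iota> y i = (if i = j then k y else \<lfloor>z y $ i / \<tau>\<rfloor>)" for y i
  define X where "X = 1 / (s * \<bar>v $ j\<bar>)"
  \<comment> \<open>The numerator is 2 because sliding changes a coordinate of \<open>y\<close>,
    itself at most 1 in absolute value, by at most 1.\<close>
  define Y where "Y = 2 / \<tau>"
  have \<tau>: "0 < \<tau>" "\<tau> \<le> 1" using assms by (auto simp: \<tau>_def mult_le_one)
  have sv: "s * \<bar>v $ i\<bar> \<le> 1" for i
    using component_le_norm_cart[of v i] assms by (meson mult_left_mono less_imp_le order_trans)
  have X: "X \<ge> 1" using sv[of j] assms(2,3) by (simp add: X_def field_simps)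
  have Y: "Y \<ge> 1" using \<tau> by (simp add: Y_def)
  have t: "0 \<le> t y" "t y < 1" for y unfolding t_def k_def using floor_correct[of "y $ j / (s * v $ j)"] by linarith+
  have y_eq: "y = z y + (s * t y) *\<^sub>R v" for y by (simp add: z_def)
  have zj: "z y $ j = s * v $ j * k y" for y
    using assms(2,3) by (simp add: z_def t_def field_simps)
  let ?P = "PiE UNIV (\<lambda>i. if i = j then {\<lfloor>- X\<rfloor>..\<lfloor>X\<rfloor>} else {\<lfloor>- Y\<rfloor>..\<lfloor>Y\<rfloor>})"
  have fl: "\<lfloor>a\<rfloor> \<in> {\<lfloor>- b\<rfloor>..\<lfloor>b\<rfloor>}" if "\<bar>a\<bar> \<le> b" for a b :: real
    using that floor_mono[of "- b" a] floor_mono[of a b] by (auto simp: abs_le_iff)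
  have range: "\<iota> y \<in> ?P" if "y \<in> G" for y
  proof -
    have y: "\<bar>y $ i\<bar> \<le> 1" for i using that assms(1) by (auto simp: mem_ccube)
    have "\<bar>y $ j / (s * v $ j)\<bar> \<le> X" using y[of j] assms(3) by (simp add: X_def abs_mult divide_right_mono)
    then have "k y \<in> {\<lfloor>- X\<rfloor>..\<lfloor>X\<rfloor>}" unfolding k_def by (rule fl)
    moreover have "\<lfloor>z y $ i / \<tau>\<rfloor> \<in> {\<lfloor>- Y\<rfloor>..\<lfloor>Y\<rfloor>}" for i
    proof -
      have "\<bar>s * t y * v $ i\<bar> = t y * (s * \<bar>v $ i\<bar>)" using t[of y] assms(3) by (simp add: abs_mult)
      also have "\<dots> \<le> 1" using t[of y] sv[of i] assms(3) by (simp add: mult_le_one)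
      finally have "\<bar>z y $ i\<bar> \<le> 2" using y[of i] by (simp add: z_def)
      then have "\<bar>z y $ i / \<tau>\<bar> \<le> Y" using \<tau> by (simp add: Y_def divide_right_mono)
      then show ?thesis by (rule fl)
    qed
    ultimately show ?thesis by (auto simp: \<iota>_def)
  qed
  have finP: "finite ?P" by (intro finite_PiE) auto
  define D where "D = (W + L * ?n) * \<tau>"
  have D: "0 \<le> D" using assms \<tau> by (simp add: D_def)
  let ?C = "\<lambda>p. f ` {y \<in> G. \<iota> y = p}"
  have C: "norm (f y - f y') \<le> D" if "y \<in> G" "y' \<in> G" "\<iota> y = \<iota> y'" for y y'
  proof -
    have k: "k y = k y'" using fun_cong[OF that(3), of j] by (simp add: \<iota>_def)
    have "norm (z y' - z y) \<le> (\<Sum>i\<in>UNIV. \<bar>(z y' - z y) $ i\<bar>)" by (rule norm_le_l1_cart)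
    also have "\<dots> \<le> (\<Sum>i\<in>(UNIV::'n set). \<tau>)"
    proof (rule sum_mono)
      fix i
      show "\<bar>(z y' - z y) $ i\<bar> \<le> \<tau>"
      proof (cases "i = j")
        case True then show ?thesis using k zj \<tau> by simp
      next
        case False
        then have "\<lfloor>z y $ i / \<tau>\<rfloor> = \<lfloor>z y' $ i / \<tau>\<rfloor>" using fun_cong[OF that(3), of i] by (simp add: \<iota>_def)
        then have "\<bar>z y' $ i / \<tau> - z y $ i / \<tau>\<bar> \<le> 1"
          using floor_correct[of "z y $ i / \<tau>"] floor_correct[of "z y' $ i / \<tau>"] by linarith
        then have "\<bar>(z y' $ i - z y $ i) / \<tau>\<bar> \<le> 1" by (simp add: diff_divide_distrib)
        then show ?thesis using \<tau> by (simp add: field_simps)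
      qed
    qed
    finally have zz: "norm (z y' - z y) \<le> ?n * \<tau>" by simp
    \<comment> \<open>Two points of one piece are joined in two moves: along \<open>v\<close> from
      \<open>y\<close> to \<open>q\<close>, where \<open>f\<close> is nearly constant, and then by
      the short vector \<open>z y' - z y\<close>, where the Lipschitz bound applies.\<close>
    define r where "r = t y' - t y"
    have r: "\<bar>r\<bar> \<le> 1" using t[of y] t[of y'] by (simp add: r_def)
    define q where "q = y + (s * r) *\<^sub>R v"
    have "y' - q = z y' - z y" using y_eq[of y] y_eq[of y'] by (simp add: q_def r_def algebra_simps)
    moreover have "q \<in> ccube 1" unfolding q_def using mem that r by blast
    ultimately have "norm (f y' - f q) \<le> L * norm (z y' - z y)" using lip[of y' q] that assms(1) by auto
    also have "\<dots> \<le> L * (?n * \<tau>)" using zz assms by (intro mult_left_mono)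
    finally have "norm (f y' - f q) \<le> L * (?n * \<tau>)" .
    moreover have "norm (f q - f y) \<le> W * \<tau>" unfolding q_def \<tau>_def using collapse that r by blast
    moreover have "norm (f y - f y') \<le> norm (f y' - f q) + norm (f q - f y)"
      using norm_triangle_ineq[of "f y' - f q" "f q - f y"] by (simp add: norm_minus_commute)
    ultimately show ?thesis by (simp add: D_def algebra_simps)
  qed
  have bdd: "bounded (?C p)" for p
  proof (cases "\<exists>y\<in>G. \<iota> y = p")
    case True
    then obtain y where "y \<in> G" "\<iota> y = p" by auto
    then show ?thesis unfolding bounded_def using C by (intro exI[of _ "f y"] exI[of _ D]) (auto simp: dist_norm)
  next
    case False
    then have "?C p = {}" by blast
    then show ?thesis by (simp only: bounded_empty)
  qed
  have diam: "diameter (?C p) \<le> D" for p using C D by (intro diameter_le) auto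
  have "hausdorff_pre ?n \<delta> (f ` G) \<le> (\<integral>\<^sup>+p. hausdorff_cost ?n (?C p) \<partial>count_space ?P)"
  proof (rule hausdorff_pre_le_countable)
    show "f ` G \<subseteq> (\<Union>p\<in>?P. ?C p)" using range by blast
    show "diameter (?C p) \<le> \<delta>" for p using diam[of p] assms(10) by (simp add: D_def \<tau>_def)
    show "0 \<le> \<delta>" using D assms(10) by (simp add: D_def \<tau>_def)
  qed (use bdd finP in \<open>auto simp: countable_finite\<close>)
  also have "\<dots> \<le> (\<integral>\<^sup>+p. ennreal (unit_ball_vol ?n * (D / 2) ^ ?n) \<partial>count_space ?P)"
    using diam bdd by (intro nn_integral_mono ennreal_leI mult_left_mono power_mono divide_right_mono)
      (auto intro: diameter_ge_0)
  also have "\<dots> = ennreal (card ?P * (unit_ball_vol ?n * (D / 2) ^ ?n))"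
    using finP D by (simp add: emeasure_count_space_finite mult.commute ennreal_mult ennreal_of_nat_eq_real_of_nat)
  also have "\<dots> \<le> ennreal (4 * X * (4 * Y) ^ (?n - 1) * (unit_ball_vol ?n * (D / 2) ^ ?n))"
  proof (intro ennreal_leI mult_right_mono)
    have "real (card ?P) = (\<Prod>i\<in>UNIV. real (card (if i = j then {\<lfloor>- X\<rfloor>..\<lfloor>X\<rfloor>} else {\<lfloor>- Y\<rfloor>..\<lfloor>Y\<rfloor>})))"
      by (subst card_PiE) auto
    also have "\<dots> \<le> (\<Prod>i\<in>UNIV. if i = j then 4 * X else 4 * Y)"
      using card_floor_interval_le X Y by (intro prod_mono) auto
    also have "\<dots> = 4 * X * (4 * Y) ^ (?n - 1)"
      by (subst prod.remove[of _ j]) (auto simp: card_Diff_singleton)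
    finally show "real (card ?P) \<le> 4 * X * (4 * Y) ^ (?n - 1)" .
  qed (use D in auto)
  \<comment> \<open>There are of the order of \<open>1 / s\<close> times
    \<open>1 / \<tau> ^ (?n - 1)\<close> pieces, each of cost of the order of
    \<open>\<tau> ^ ?n\<close>. What remains is \<open>\<tau> / s\<close>, which is
    \<theta>.\<close>
  also have "4 * X * (4 * Y) ^ (?n - 1) * (unit_ball_vol ?n * (D / 2) ^ ?n) =
    4 / \<bar>v $ j\<bar> * 8 ^ (?n - 1) * unit_ball_vol ?n * ((W + L * ?n) / 2) ^ ?n * \<theta>"
  proof -
    obtain N where N: "?n = Suc N" by (metis Suc_pred zero_less_card_finite)
    have Y\<tau>: "(4 * Y) ^ N * \<tau> ^ Suc N = 8 ^ N * \<tau>"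
      using \<tau> by (simp add: Y_def power_divide)
    have X\<tau>: "X * \<tau> = \<theta> / \<bar>v $ j\<bar>" using assms(3) by (simp add: X_def \<tau>_def)
    define d where "d = ((W + L * ?n) / 2) ^ Suc N"
    have "(D / 2) ^ Suc N = d * \<tau> ^ Suc N"
      unfolding d_def D_def power_mult_distrib[symmetric] by simp
    then have "4 * X * (4 * Y) ^ N * (unit_ball_vol ?n * (D / 2) ^ Suc N)
      = 4 * X * unit_ball_vol ?n * d * ((4 * Y) ^ N * \<tau> ^ Suc N)"
      by simp
    also have "\<dots> = 4 * 8 ^ N * unit_ball_vol ?n * d * (X * \<tau>)" unfolding Y\<tau> by simp
    also have "\<dots> = 4 / \<bar>v $ j\<bar> * 8 ^ N * unit_ball_vol ?n * d * \<theta>" unfolding X\<tau> by simp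
    finally show ?thesis unfolding d_def N by simp
  qed
  finally show ?thesis .
qed


section \<open>The space of 1-Lipschitz maps\<close>

locale lip_space = A: vector_norm Na + B: vector_norm Nb
  for Na :: "real^'n \<Rightarrow> real" and Nb :: "real^'m \<Rightarrow> real"
begin

abbreviation M :: "(real^'n \<Rightarrow> real^'m) set" where
  "M \<equiv> Lip1 cube (\<lambda>x y. Na (x - y)) (\<lambda>x y. Nb (x - y))"

abbreviation d :: "(real^'n \<Rightarrow> real^'m) \<Rightarrow> (real^'n \<Rightarrow> real^'m) \<Rightarrow> real" where
  "d \<equiv> sup_dist cube (\<lambda>x y. Nb (x - y))"

lemma zero_in_cube: "0 \<in> (cube :: (real^'n) set)"
  by (simp add: cube_def)

lemma Na_bounded_on_cube: obtains R where "R > 0" "\<And>x. x \<in> cube \<Longrightarrow> Na x \<le> R"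
proof -
  obtain C where C: "C > 0" "\<And>x. Na x \<le> C * norm x" using A.le_norm by blast
  obtain R where R: "R > 0" "\<And>x::real^'n. x \<in> cube \<Longrightarrow> norm x \<le> R"
    using bounded_cbox[unfolded bounded_pos] unfolding cube_eq_ccube by metis
  show ?thesis
  proof
    show "C * R > 0" using C R by simp
    show "Na x \<le> C * R" if "x \<in> cube" for x
      using C(2)[of x] mult_left_mono[OF R(2)[OF that], of C] C(1) by linarith
  qed
qed

lemma MD: "f \<in> M \<Longrightarrow> x \<in> cube \<Longrightarrow> y \<in> cube \<Longrightarrow> Nb (f x - f y) \<le> Na (x - y)"
  by (simp add: Lip1_def)

lemma M_outside: "f \<in> M \<Longrightarrow> x \<notin> cube \<Longrightarrow> f x = 0"
  by (simp add: Lip1_def)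

text \<open>Boundedness comes for free, since the cube is bounded with respect to
  \<open>Na\<close>.\<close>

lemma MI:
  assumes "\<And>x y. x \<in> cube \<Longrightarrow> y \<in> cube \<Longrightarrow> Nb (f x - f y) \<le> Na (x - y)"
    and "\<And>x. x \<notin> cube \<Longrightarrow> f x = 0"
  shows "f \<in> M"
proof -
  obtain R where R: "\<And>x. x \<in> cube \<Longrightarrow> Na x \<le> R" using Na_bounded_on_cube by blast
  have "Nb (f x - f y) \<le> R + R" if "x \<in> cube" "y \<in> cube" for x y
    using assms(1)[OF that] A.triangle_diff[of x y 0] R[OF that(1)] R[OF that(2)] by simp
  then show ?thesis using assms unfolding Lip1_def by blast
qed

lemma M_bounded:
  assumes "f \<in> M"
  obtains C where "C > 0" "\<And>x. x \<in> cube \<Longrightarrow> Nb (f x) \<le> C"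
proof -
  obtain R where R: "R > 0" "\<And>x. x \<in> cube \<Longrightarrow> Na x \<le> R" using Na_bounded_on_cube by blast
  show ?thesis
  proof
    show "R + Nb (f 0) > 0" using R(1) by (simp add: add_pos_nonneg)
    show "Nb (f x) \<le> R + Nb (f 0)" if "x \<in> cube" for x
      using MD[OF assms that zero_in_cube] R(2)[OF that] B.triangle_diff[of "f x" 0 "f 0"] by simp
  qed
qed

lemma dist_le: "(\<And>x. x \<in> cube \<Longrightarrow> Nb (f x - g x) \<le> e) \<Longrightarrow> d f g \<le> e"
  unfolding sup_dist_def using zero_in_cube by (intro cSUP_least) auto

lemma dist_ge:
  assumes "f \<in> M" "g \<in> M" "x \<in> cube"
  shows "Nb (f x - g x) \<le> d f g"
proof -
  obtain C D where "\<And>x. x \<in> cube \<Longrightarrow> Nb (f x) \<le> C" "\<And>x. x \<in> cube \<Longrightarrow> Nb (g x) \<le> D"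
    using M_bounded[OF assms(1)] M_bounded[OF assms(2)] by metis
  then have "Nb (f y - g y) \<le> C + D" if "y \<in> cube" for y
    using B.triangle_diff[of "f y" "g y" 0] that by (fastforce intro: order_trans add_mono)
  then show ?thesis unfolding sup_dist_def using assms(3) by (intro cSUP_upper) (auto intro!: bdd_aboveI)
qed

lemma dist_nonneg: "f \<in> M \<Longrightarrow> g \<in> M \<Longrightarrow> 0 \<le> d f g"
  using dist_ge[OF _ _ zero_in_cube, of f g] B.nonneg[of "f 0 - g 0"] by linarith

lemma dist_commute: "d f g = d g f"
  unfolding sup_dist_def by (simp add: B.minus_commute)

lemma dist_eq_0_iff:
  assumes "f \<in> M" "g \<in> M"
  shows "d f g = 0 \<longleftrightarrow> f = g"
proof
  assume "d f g = 0"
  show "f = g"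
  proof
    fix x show "f x = g x"
    proof (cases "x \<in> cube")
      case True
      then have "Nb (f x - g x) = 0"
        using dist_ge[OF assms True] \<open>d f g = 0\<close> B.nonneg[of "f x - g x"] by linarith
      then show ?thesis by (simp add: B.eq_0_iff)
    qed (simp add: M_outside[OF assms(1)] M_outside[OF assms(2)])
  qed
next
  assume "f = g"
  then show "d f g = 0" using dist_le[of f g 0] dist_nonneg[OF assms] by simp
qed

lemma dist_triangle:
  assumes "f \<in> M" "g \<in> M" "h \<in> M"
  shows "d f h \<le> d f g + d g h"
proof (rule dist_le)
  fix x :: "real^'n" assume x: "x \<in> cube"
  show "Nb (f x - h x) \<le> d f g + d g h"
    using B.triangle_diff[of "f x" "h x" "g x"] dist_ge[OF assms(1,2) x] dist_ge[OF assms(2,3) x] by linarith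
qed

text \<open>The library's metric spaces need a distance that is nonnegative for all arguments.\<close>
definition dM :: "(real^'n \<Rightarrow> real^'m) \<Rightarrow> (real^'n \<Rightarrow> real^'m) \<Rightarrow> real" where
  "dM f g = (if f \<in> M \<and> g \<in> M then d f g else 0)"

sublocale MS: Metric_space M dM
proof
  show "dM f g \<le> dM f h + dM h g" if "f \<in> M" "h \<in> M" "g \<in> M" for f g h
    using dist_triangle that by (simp add: dM_def)
qed (auto simp: dM_def dist_nonneg dist_commute dist_eq_0_iff)

text \<open>Cauchy sequences converge pointwise on the cube, and the Lipschitz bound and the uniform
  estimate survive in the limit. Completeness is what Baire's theorem requires.\<close>

lemma complete: "MS.mcomplete"
  unfolding MS.mcomplete_def
proof (intro allI impI)
  fix \<sigma> :: "nat \<Rightarrow> real^'n \<Rightarrow> real^'m" assume "MS.MCauchy \<sigma>"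
  then have M: "\<sigma> k \<in> M" and cauchy: "\<And>e. e > 0 \<Longrightarrow> \<exists>K. \<forall>k k'. K \<le> k \<longrightarrow> K \<le> k' \<longrightarrow> d (\<sigma> k) (\<sigma> k') < e" for k
    by (auto simp: MS.MCauchy_def dM_def image_subset_iff)
  obtain C where C: "C > 0" "\<And>x. norm x \<le> C * Nb x" using B.norm_le by blast
  have "convergent (\<lambda>k. \<sigma> k x)" if x: "x \<in> cube" for x
  proof -
    have "Cauchy (\<lambda>k. \<sigma> k x)"
    proof (rule metric_CauchyI)
      fix e :: real assume "e > 0"
      then obtain K where K: "\<And>k k'. K \<le> k \<Longrightarrow> K \<le> k' \<Longrightarrow> d (\<sigma> k) (\<sigma> k') < e / C"
        using cauchy[of "e / C"] C(1) by auto
      have "dist (\<sigma> k x) (\<sigma> k' x) < e" if "K \<le> k" "K \<le> k'" for k k'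
      proof -
        have "Nb (\<sigma> k x - \<sigma> k' x) < e / C" using K[OF that] dist_ge[OF M M x, of k k'] by linarith
        then have "C * Nb (\<sigma> k x - \<sigma> k' x) < e" using C(1) by (simp add: field_simps)
        then show ?thesis using C(2)[of "\<sigma> k x - \<sigma> k' x"] by (simp add: dist_norm)
      qed
      then show "\<exists>K. \<forall>k\<ge>K. \<forall>k'\<ge>K. dist (\<sigma> k x) (\<sigma> k' x) < e" by blast
    qed
    then show ?thesis by (simp add: Cauchy_convergent_iff)
  qed
  then obtain g0 where g0: "\<And>x. x \<in> cube \<Longrightarrow> (\<lambda>k. \<sigma> k x) \<longlonglongrightarrow> g0 x"
    unfolding convergent_def by metis
  define g where "g x = (if x \<in> cube then g0 x else 0)" for x
  have g: "(\<lambda>k. \<sigma> k x) \<longlonglongrightarrow> g x" if "x \<in> cube" for x using g0[OF that] that by (simp add: g_def)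
  have tends_Nb: "(\<lambda>k. Nb (F k)) \<longlonglongrightarrow> Nb l" if "F \<longlonglongrightarrow> l" for F l
    using continuous_on_tendsto_compose[OF B.continuous_on_N[of UNIV] that] by auto
  have gM: "g \<in> M"
  proof (rule MI)
    fix x y :: "real^'n" assume xy: "x \<in> cube" "y \<in> cube"
    have "(\<lambda>k. Nb (\<sigma> k x - \<sigma> k y)) \<longlonglongrightarrow> Nb (g x - g y)"
      by (intro tends_Nb tendsto_diff g xy)
    then show "Nb (g x - g y) \<le> Na (x - y)" by (rule LIMSEQ_le_const2) (use MD[OF M xy] in blast)
  qed (simp add: g_def)
  have "\<exists>K. \<forall>k\<ge>K. \<sigma> k \<in> M \<and> dM (\<sigma> k) g < e" if "e > 0" for e
  proof -
    obtain K where K: "\<And>k k'. K \<le> k \<Longrightarrow> K \<le> k' \<Longrightarrow> d (\<sigma> k) (\<sigma> k') < e / 2"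
      using cauchy[of "e / 2"] \<open>e > 0\<close> by auto
    have "d (\<sigma> k) g \<le> e / 2" if "K \<le> k" for k
    proof (rule dist_le)
      fix x :: "real^'n" assume x: "x \<in> cube"
      have "(\<lambda>k'. Nb (\<sigma> k x - \<sigma> k' x)) \<longlonglongrightarrow> Nb (\<sigma> k x - g x)"
        by (intro tends_Nb tendsto_diff g x tendsto_const)
      then show "Nb (\<sigma> k x - g x) \<le> e / 2"
      proof (rule LIMSEQ_le_const2)
        have "Nb (\<sigma> k x - \<sigma> k' x) \<le> e / 2" if "K \<le> k'" for k'
          using K[OF \<open>K \<le> k\<close> that] dist_ge[OF M M x, of k k'] by linarith
        then show "\<exists>N. \<forall>n\<ge>N. Nb (\<sigma> k x - \<sigma> n x) \<le> e / 2" by blast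
      qed
    qed
    then have "dM (\<sigma> k) g < e" if "K \<le> k" for k using that M gM \<open>e > 0\<close> by (fastforce simp: dM_def)
    then show ?thesis using M by blast
  qed
  then have "limitin MS.mtopology \<sigma> g sequentially" using gM by (simp add: MS.limit_metric_sequentially)
  then show "\<exists>g. limitin MS.mtopology \<sigma> g sequentially" by blast
qed

text \<open>By Baire's theorem a residual set is dense, so it cannot avoid a ball; this is how
  residuality gets refuted for \<Delta> > 0.\<close>

lemma residual_meets_ball:
  assumes "residual_in M d S" "f \<in> M" "e > 0"
  obtains g where "g \<in> M" "g \<in> S" "d f g < e"
proof -
  obtain U :: "nat \<Rightarrow> (real^'n \<Rightarrow> real^'m) set"
    where "(\<forall>k. open_in_metric M d (U k) \<and> dense_in_metric M d (U k)) \<and> M \<inter> (\<Inter>k. U k) \<subseteq> S"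
    using assms(1) unfolding residual_in_def by (elim exE)
  then have U: "open_in_metric M d (U k)" "dense_in_metric M d (U k)" "M \<inter> (\<Inter>k. U k) \<subseteq> S" for k
    by simp_all
  have "openin MS.mtopology (U k) \<and> MS.mtopology closure_of (U k) = M" for k
  proof
    have sub: "U k \<subseteq> M" using U(1)[of k] by (simp add: open_in_metric_def)
    show "openin MS.mtopology (U k)"
      unfolding MS.openin_mtopology
    proof (intro conjI allI impI sub)
      fix f assume "f \<in> U k"
      then obtain e where "e > 0" "\<And>g. g \<in> M \<Longrightarrow> d f g < e \<Longrightarrow> g \<in> U k"
        using U(1)[of k] unfolding open_in_metric_def by blast
      then show "\<exists>r>0. MS.mball f r \<subseteq> U k" by (intro exI[of _ e]) (auto simp: dM_def)
    qed
    have "\<exists>g\<in>U k. g \<in> MS.mball f r" if "f \<in> M" "r > 0" for f r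
    proof -
      obtain g where "g \<in> U k" "d f g < r" using U(2)[of k] \<open>f \<in> M\<close> \<open>r > 0\<close> unfolding dense_in_metric_def by blast
      then show ?thesis using sub \<open>f \<in> M\<close> by (intro bexI[of _ g]) (auto simp: dM_def)
    qed
    then show "MS.mtopology closure_of (U k) = M" unfolding MS.metric_closure_of by blast
  qed
  then have "MS.mtopology closure_of (\<Inter>k. U k) = M"
    by (intro MS.metric_Baire_category[OF complete]) auto
  then obtain g where "g \<in> (\<Inter>k. U k)" "g \<in> MS.mball f e"
    using assms(2,3) unfolding MS.metric_closure_of by blast
  moreover from this have "g \<in> M" "d f g < e" by (auto simp: dM_def split: if_splits)
  ultimately show ?thesis using U(3) that[of g] by blast
qed

end


section \<open>Positive measure is generic\<close>

text \<open>Clamping to [0, 1] does not increase differences, and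
  \<open>ln (b / a) \<le> b / a - 1\<close> turns the logarithmic increment, weighted by the smaller
  radius \<open>a\<close>, into \<open>b - a\<close>.\<close>

lemma clamp_ln_diff_le:
  fixes a b r \<Lambda> :: real
  defines "\<xi> \<equiv> \<lambda>t. min 1 (max 0 (ln (t / r) / \<Lambda>))"
  assumes "0 < a" "a \<le> b" "0 < r" "0 < \<Lambda>"
  shows "a * \<bar>\<xi> b - \<xi> a\<bar> \<le> (b - a) / \<Lambda>"
proof -
  have "ln (b / r) - ln (a / r) = ln (b / a)" using assms by (simp add: ln_div)
  moreover have "ln (b / a) \<le> b / a - 1" using assms by (intro ln_le_minus_one) auto
  moreover have "0 \<le> ln (b / a)" using assms by (intro ln_ge_zero) auto
  ultimately have le: "ln (a / r) \<le> ln (b / r)" "ln (b / r) - ln (a / r) \<le> b / a - 1" by linarith+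
  then have "ln (a / r) / \<Lambda> \<le> ln (b / r) / \<Lambda>" using assms by (simp add: divide_right_mono)
  then have "\<bar>\<xi> b - \<xi> a\<bar> \<le> ln (b / r) / \<Lambda> - ln (a / r) / \<Lambda>" unfolding \<xi>_def by linarith
  also have "\<dots> = (ln (b / r) - ln (a / r)) / \<Lambda>" by (simp add: diff_divide_distrib)
  also have "\<dots> \<le> (b / a - 1) / \<Lambda>" using le assms by (intro divide_right_mono) auto
  finally have "a * \<bar>\<xi> b - \<xi> a\<bar> \<le> a * ((b / a - 1) / \<Lambda>)" using assms by (intro mult_left_mono) auto
  also have "\<dots> = (b - a) / \<Lambda>" using assms by (simp add: field_simps)
  finally show ?thesis .
qed

text \<open>In an arbitrary norm, cutting off linearly between two radii costs a factor bounded away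
  from 1; the logarithmic cutoff between the radii \<open>R exp (- \<Lambda>)\<close> and \<open>R\<close> costs only \<open>1 + 1 / \<Lambda>\<close>.\<close>
lemma (in vector_norm) logarithmic_cutoff:
  assumes "R > 0" "\<Lambda> > 0"
  obtains \<Phi> r where "r > 0" "\<And>x. \<exists>c. 0 \<le> c \<and> c \<le> 1 \<and> \<Phi> x = c *\<^sub>R x"
    "\<And>x y. N (\<Phi> x - \<Phi> y) \<le> (1 + 1 / \<Lambda>) * N (x - y)"
    "\<And>x. N (\<Phi> x - x) \<le> R" "\<And>x. N x \<le> r \<Longrightarrow> \<Phi> x = 0"
proof -
  \<comment> \<open>With this inner radius, \<open>ln (t / r) / \<Lambda>\<close> runs exactly from
    0 at \<open>r\<close> to 1 at \<open>R\<close>.\<close>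
  define r where "r = R * exp (- \<Lambda>)"
  define \<xi> where "\<xi> t = min 1 (max 0 (ln (t / r) / \<Lambda>))" for t :: real
  define \<Phi> where "\<Phi> x = \<xi> (N x) *\<^sub>R x" for x
  have r: "r > 0" using assms by (simp add: r_def)
  have \<xi>: "0 \<le> \<xi> t" "\<xi> t \<le> 1" for t by (auto simp: \<xi>_def)
  have lip: "N (\<Phi> x - \<Phi> y) \<le> (1 + 1 / \<Lambda>) * N (x - y)" if "N y \<le> N x" for x y
  proof -
    have *: "N y * \<bar>\<xi> (N x) - \<xi> (N y)\<bar> \<le> (N x - N y) / \<Lambda>"
    proof (cases "y = 0")
      case False
      then show ?thesis unfolding \<xi>_def using that r assms by (intro clamp_ln_diff_le) (auto simp: pos_iff)
    qed (use assms in simp)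
    \<comment> \<open>The increment of \<xi> is made to multiply \<open>y\<close>, the vector of
      smaller norm, as the logarithmic estimate demands.\<close>
    have "\<Phi> x - \<Phi> y = \<xi> (N x) *\<^sub>R (x - y) + (\<xi> (N x) - \<xi> (N y)) *\<^sub>R y"
      by (simp add: \<Phi>_def algebra_simps)
    then have "N (\<Phi> x - \<Phi> y) \<le> \<xi> (N x) * N (x - y) + \<bar>\<xi> (N x) - \<xi> (N y)\<bar> * N y"
      using triangle[of "\<xi> (N x) *\<^sub>R (x - y)" "(\<xi> (N x) - \<xi> (N y)) *\<^sub>R y"] \<xi>[of "N x"] by (simp add: scaleR)
    also have "\<xi> (N x) * N (x - y) \<le> 1 * N (x - y)" using \<xi> by (intro mult_right_mono) auto
    also have "\<bar>\<xi> (N x) - \<xi> (N y)\<bar> * N y \<le> (N x - N y) / \<Lambda>" using * by (simp add: mult.commute)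
    also have "\<dots> \<le> N (x - y) / \<Lambda>"
      using reverse_triangle[of x y] assms by (intro divide_right_mono) auto
    finally show ?thesis by (simp add: algebra_simps)
  qed
  show ?thesis
  proof
    show "\<exists>c. 0 \<le> c \<and> c \<le> 1 \<and> \<Phi> x = c *\<^sub>R x" for x using \<xi> by (auto simp: \<Phi>_def)
    show "N (\<Phi> x - \<Phi> y) \<le> (1 + 1 / \<Lambda>) * N (x - y)" for x y
      using lip[of x y] lip[of y x] minus_commute[of x y] minus_commute[of "\<Phi> x" "\<Phi> y"] by (cases "N y \<le> N x") auto
    show "\<Phi> x = 0" if "N x \<le> r" for x
    proof (cases "x = 0")
      case False
      then have "ln (N x / r) \<le> 0" using that r by (simp add: pos_iff)
      then have "ln (N x / r) / \<Lambda> \<le> 0" using assms by (simp add: divide_nonpos_pos)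
      then show ?thesis by (simp add: \<Phi>_def \<xi>_def)
    qed (simp add: \<Phi>_def)
    show "N (\<Phi> x - x) \<le> R" for x
    proof (cases "N x \<le> R")
      case True
      have "\<Phi> x - x = (\<xi> (N x) - 1) *\<^sub>R x" by (simp add: \<Phi>_def algebra_simps)
      then have "N (\<Phi> x - x) = (1 - \<xi> (N x)) * N x" using \<xi>[of "N x"] by (simp add: scaleR)
      also have "\<dots> \<le> 1 * N x" using \<xi> by (intro mult_right_mono) auto
      finally show ?thesis using True by simp
    next
      case False
      have "\<Lambda> = ln (R / r)" using assms by (simp add: r_def exp_minus field_simps)
      also have "\<dots> \<le> ln (N x / r)" using False r assms(1) by (intro ln_mono divide_right_mono) auto
      finally have "1 \<le> ln (N x / r) / \<Lambda>" using assms by (simp add: field_simps)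
      then show ?thesis using assms by (simp add: \<Phi>_def \<xi>_def)
    qed
  qed (rule r)
qed

lemma linear_embedding_cart:
  assumes "CARD('n) \<le> CARD('m)"
  obtains L :: "real^'n \<Rightarrow> real^'m" and P where "linear L" "linear P" "\<And>x. P (L x) = x"
proof -
  obtain \<iota> :: "'n \<Rightarrow> 'm" where \<iota>: "inj \<iota>"
    using card_le_inj[of "UNIV :: 'n set" "UNIV :: 'm set"] assms by auto
  define L :: "real^'n \<Rightarrow> real^'m" where "L x = (\<chi> k. if k \<in> range \<iota> then x $ (inv \<iota> k) else 0)" for x
  define P :: "real^'m \<Rightarrow> real^'n" where "P y = (\<chi> i. y $ \<iota> i)" for y
  show ?thesis
  proof
    show "linear L" by (rule linearI) (auto simp: L_def vec_eq_iff)
    show "linear P" by (rule linearI) (auto simp: P_def vec_eq_iff)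
    show "P (L x) = x" for x using \<iota> by (simp add: P_def L_def vec_eq_iff)
  qed
qed

section \<open>Stable positivity of the measure\<close>

context lip_space
begin

lemma M_norm_lipschitz:
  obtains L where "L > 0"
    "\<And>f x y. f \<in> M \<Longrightarrow> x \<in> cube \<Longrightarrow> y \<in> cube \<Longrightarrow> norm (f x - f y) \<le> L * norm (x - y)"
proof -
  obtain C where C: "C > 0" "\<And>x. norm x \<le> C * Nb x" using B.norm_le by blast
  obtain D where D: "D > 0" "\<And>x. Na x \<le> D * norm x" using A.le_norm by blast
  show ?thesis
  proof
    show "C * D > 0" using C D by simp
    fix f and x y :: "real^'n" assume "f \<in> M" "x \<in> cube" "y \<in> cube"
    then have "Nb (f x - f y) \<le> D * norm (x - y)" using MD[of f x y] D(2)[of "x - y"] by linarith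
    then have "C * Nb (f x - f y) \<le> C * (D * norm (x - y))" using C(1) by (intro mult_left_mono) auto
    then show "norm (f x - f y) \<le> C * D * norm (x - y)" using C(2)[of "f x - f y"] by simp
  qed
qed

lemma M_continuous:
  assumes "f \<in> M"
  shows "continuous_on cube f"
proof -
  obtain L where L: "L > 0" "\<And>f x y. f \<in> M \<Longrightarrow> x \<in> cube \<Longrightarrow> y \<in> cube \<Longrightarrow> norm (f x - f y) \<le> L * norm (x - y)"
    using M_norm_lipschitz by blast
  have "L-lipschitz_on cube f" using L assms by (intro lipschitz_onI) (auto simp: dist_norm)
  then show ?thesis by (rule lipschitz_on_continuous_on)
qed

text \<open>Being affine and injective on a small ball makes the measure stably positive: by Brouwer's
  theorem the projection of every nearby image still contains a ball.\<close>
lemma stably_positive: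
  fixes L :: "real^'n \<Rightarrow> real^'m"
  assumes "g \<in> M" "linear P" "\<And>x. P (L x) = x" "\<rho> > 0" "\<rho> \<le> 1" "\<theta> > 0"
    and g: "\<And>x. x \<in> cball 0 \<rho> \<Longrightarrow> g x = c + \<theta> *\<^sub>R L x"
  obtains \<epsilon> where "\<epsilon> > 0" "\<And>h. h \<in> M \<Longrightarrow> d g h < \<epsilon> \<Longrightarrow> hausdorff_measure CARD('n) (h ` cube) > 0"
proof -
  obtain K where K: "K > 0" "\<And>x. norm (P x) \<le> K * norm x" using linear_bounded_pos[OF assms(2)] by blast
  obtain C where C: "C > 0" "\<And>x. norm x \<le> C * Nb x" using B.norm_le by blast
  \<comment> \<open>This makes the projected error at most half of \<open>\<theta> * \<rho>\<close>,
    leaving the other half for the radius of the ball to be covered.\<close>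
  define \<epsilon> where "\<epsilon> = \<theta> * \<rho> / (2 * (K * C))"
  have cball: "cball 0 \<rho> \<subseteq> (cube :: (real^'n) set)"
    using assms(5) by (auto simp: cube_def intro: order_trans[OF component_le_norm_cart])
  show ?thesis
  proof
    show "\<epsilon> > 0" using K C assms by (simp add: \<epsilon>_def)
    fix h assume h: "h \<in> M" "d g h < \<epsilon>"
    define err where "err x = P (h x - g x)" for x
    have err: "norm (err x) \<le> \<theta> * \<rho> / 2" if "x \<in> cball 0 \<rho>" for x
    proof -
      have "Nb (h x - g x) \<le> \<epsilon>"
        using dist_ge[OF assms(1) h(1), of x] h(2) that cball B.minus_commute[of "h x" "g x"] by auto
      then have "norm (h x - g x) \<le> C * \<epsilon>"
        using C(2)[of "h x - g x"] C(1) by (meson mult_left_mono less_imp_le order_trans)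
      then have "norm (err x) \<le> K * (C * \<epsilon>)"
        unfolding err_def using K by (meson mult_left_mono less_imp_le order_trans)
      also have "\<dots> = \<theta> * \<rho> / 2" using K C by (simp add: \<epsilon>_def)
      finally show ?thesis .
    qed
    have Ph: "P (h x) = P c + \<theta> *\<^sub>R x + err x" if "x \<in> cball 0 \<rho>" for x
      using g[OF that] assms(2,3) by (simp add: err_def linear_diff linear_add linear_scale)
    have "cball (P c) (\<theta> * \<rho> / 2) \<subseteq> P ` h ` cube"
    proof
      fix y assume y: "y \<in> cball (P c) (\<theta> * \<rho> / 2)"
      \<comment> \<open>The fixed points of \<open>F\<close> are the solutions of
        \<open>P (h x) = y\<close>.\<close>
      define F where "F x = x - (1 / \<theta>) *\<^sub>R (P (h x) - y)" for x
      have F_eq: "F x = (1 / \<theta>) *\<^sub>R ((y - P c) - err x)" if "x \<in> cball 0 \<rho>" for x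
        using Ph[OF that] assms(6) by (simp add: F_def algebra_simps)
      have "continuous_on (cball 0 \<rho>) (\<lambda>x. P (h x))"
        using linear_continuous_on_compose[OF continuous_on_subset[OF M_continuous[OF h(1)] cball] assms(2)] .
      then have "continuous_on (cball 0 \<rho>) F" unfolding F_def by (intro continuous_intros)
      moreover have "F \<in> cball 0 \<rho> \<rightarrow> cball 0 \<rho>"
      proof
        fix x :: "real^'n" assume x: "x \<in> cball 0 \<rho>"
        have "norm ((y - P c) - err x) \<le> \<theta> * \<rho>"
          using norm_triangle_ineq4[of "y - P c" "err x"] err[OF x] y by (simp add: dist_norm norm_minus_commute)
        then have "norm (F x) \<le> (1 / \<theta>) * (\<theta> * \<rho>)"
          unfolding F_eq[OF x] norm_scaleR using assms(6) by (intro mult_mono) auto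
        then show "F x \<in> cball 0 \<rho>" using assms(6) by simp
      qed
      ultimately obtain x where x: "x \<in> cball 0 \<rho>" "F x = x"
        using brouwer_ball[of \<rho> 0 F] assms(4) by blast
      then have "P (h x) = y" using assms(6) by (simp add: F_def)
      then show "y \<in> P ` h ` cube" using x cball by blast
    qed
    then have "hausdorff_measure DIM(real^'n) (h ` cube) > 0"
      by (rule hausdorff_measure_pos_if_image_contains_ball[OF assms(2)]) (use assms in simp)
    then show "hausdorff_measure CARD('n) (h ` cube) > 0" by simp
  qed
qed

lemma stably_positive_dense:
  assumes "CARD('n) \<le> CARD('m)" "f \<in> M" "e > 0"
  obtains g \<epsilon> where "g \<in> M" "d f g < e" "\<epsilon> > 0"
    "\<And>h. h \<in> M \<Longrightarrow> d g h < \<epsilon> \<Longrightarrow> hausdorff_measure CARD('n) (h ` cube) > 0"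
proof -
  obtain L :: "real^'n \<Rightarrow> real^'m" and P where LP: "linear L" "linear P" "\<And>x. P (L x) = x"
    using linear_embedding_cart[OF assms(1)] by blast
  obtain C1 where C1: "C1 > 0" "\<And>x. Nb x \<le> C1 * norm x" using B.le_norm by blast
  obtain C2 where C2: "C2 > 0" "\<And>x. norm (L x) \<le> C2 * norm x" using linear_bounded_pos[OF LP(1)] by blast
  obtain C3 where C3: "C3 > 0" "\<And>x. norm x \<le> C3 * Na x" using A.norm_le by blast
  obtain C4 where C4: "C4 > 0" "\<And>x. Na x \<le> C4 * norm x" using A.le_norm by blast
  obtain Bf where Bf: "Bf > 0" "\<And>x. x \<in> cube \<Longrightarrow> Nb (f x) \<le> Bf" using M_bounded[OF assms(2)] by blast
  obtain R0 where R0: "R0 > 0" "\<And>x. x \<in> cube \<Longrightarrow> Na x \<le> R0" using Na_bounded_on_cube by blast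
  define CL where "CL = C1 * (C2 * C3)"
  have CL: "CL > 0" "Nb (L x) \<le> CL * Na x" for x
  proof -
    show "CL > 0" using C1 C2 C3 by (simp add: CL_def)
    have "norm (L x) \<le> C2 * (C3 * Na x)" using C2 C3(2)[of x] by (meson mult_left_mono less_imp_le order_trans)
    then have "C1 * norm (L x) \<le> C1 * (C2 * (C3 * Na x))" using C1 by (intro mult_left_mono) auto
    then show "Nb (L x) \<le> CL * Na x" using C1(2)[of "L x"] by (simp add: CL_def mult.assoc)
  qed
  \<comment> \<open>The shrinking factor \<open>1 - \<eta>\<close> pays for the Lipschitz constant
    \<open>1 + \<eta> / 2\<close> of the cutoff and for a linear term of constant
    \<open>\<eta> / 2\<close>, because
    \<open>(1 - \<eta>) * (1 + \<eta> / 2) + \<eta> / 2 < 1\<close>. Shrinking itself moves the map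
    by at most \<open>e / 4\<close>.\<close>
  define \<eta> where "\<eta> = e / (4 * (Bf + e))"
  have \<eta>: "0 < \<eta>" "\<eta> < 1" "\<eta> * Bf \<le> e / 4"
    using assms(3) Bf(1) by (auto simp: \<eta>_def field_simps)
  \<comment> \<open>The first bound keeps the linear term within its Lipschitz allowance, the second
    keeps it below \<open>e / 5\<close> on the cube. Taking a fifth leaves the sum of the three
    errors strictly below \<open>e\<close>.\<close>
  define \<theta> where "\<theta> = min (\<eta> / 2) (e / (5 * R0)) / CL"
  have "\<theta> * CL = min (\<eta> / 2) (e / (5 * R0))" using CL(1) by (simp add: \<theta>_def)
  moreover have "e / (5 * R0) * R0 = e / 5" using R0(1) by simp
  ultimately have \<theta>: "\<theta> > 0" "\<theta> * CL \<le> \<eta> / 2" "\<theta> * CL * R0 \<le> e / 5"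
    using \<eta> assms(3) R0(1) CL(1) mult_right_mono[of "\<theta> * CL" "e / (5 * R0)" R0] by (auto simp: \<theta>_def)
  obtain \<Phi> r where \<Phi>: "r > 0" "\<And>x. \<exists>c. 0 \<le> c \<and> c \<le> 1 \<and> \<Phi> x = c *\<^sub>R x"
    "\<And>x y. Na (\<Phi> x - \<Phi> y) \<le> (1 + 1 / (2 / \<eta>)) * Na (x - y)"
    "\<And>x. Na (\<Phi> x - x) \<le> e / 4" "\<And>x. Na x \<le> r \<Longrightarrow> \<Phi> x = 0"
    using A.logarithmic_cutoff[of "e / 4" "2 / \<eta>"] assms(3) \<eta>(1) by (metis divide_pos_pos zero_less_numeral)
  \<comment> \<open>The cutoff only pulls points towards the origin, and the cube is star-shaped
    about it.\<close>
  have \<Phi>_cube: "\<Phi> x \<in> cube" if "x \<in> cube" for x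
  proof -
    obtain c where c: "0 \<le> c" "c \<le> 1" "\<Phi> x = c *\<^sub>R x" using \<Phi>(2) by blast
    then show ?thesis using that by (auto simp: cube_def abs_mult intro: mult_le_one)
  qed
  define g where "g x = (if x \<in> cube then (1 - \<eta>) *\<^sub>R f (\<Phi> x) + \<theta> *\<^sub>R L x else 0)" for x
  have gM: "g \<in> M"
  proof (rule MI)
    fix x y :: "real^'n" assume xy: "x \<in> cube" "y \<in> cube"
    have "g x - g y = (1 - \<eta>) *\<^sub>R (f (\<Phi> x) - f (\<Phi> y)) + \<theta> *\<^sub>R L (x - y)"
      using xy LP(1) by (simp add: g_def linear_diff algebra_simps)
    then have "Nb (g x - g y) \<le> (1 - \<eta>) * Nb (f (\<Phi> x) - f (\<Phi> y)) + \<theta> * Nb (L (x - y))"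
      using B.triangle[of "(1 - \<eta>) *\<^sub>R (f (\<Phi> x) - f (\<Phi> y))" "\<theta> *\<^sub>R L (x - y)"] \<eta> \<theta> by (simp add: B.scaleR)
    also have "\<dots> \<le> (1 - \<eta>) * ((1 + \<eta> / 2) * Na (x - y)) + \<theta> * (CL * Na (x - y))"
      using MD[OF assms(2) \<Phi>_cube[OF xy(1)] \<Phi>_cube[OF xy(2)]] \<Phi>(3)[of x y] CL(2)[of "x - y"] \<eta> \<theta>
      by (intro add_mono mult_left_mono) auto
    also have "\<dots> = ((1 - \<eta>) * (1 + \<eta> / 2) + \<theta> * CL) * Na (x - y)" by (simp add: algebra_simps)
    also have "\<dots> \<le> 1 * Na (x - y)"
    proof (rule mult_right_mono)
      have "(1 - \<eta>) * (1 + \<eta> / 2) + \<eta> / 2 = 1 - \<eta> * \<eta> / 2" by (simp add: field_simps)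
      then show "(1 - \<eta>) * (1 + \<eta> / 2) + \<theta> * CL \<le> 1" using \<theta>(2) \<eta>(1) by (smt (verit) mult_pos_pos half_gt_zero)
    qed simp
    finally show "Nb (g x - g y) \<le> Na (x - y)" by simp
  qed (simp add: g_def)
  have "d f g \<le> e / 4 + e / 4 + e / 5"
  proof (rule dist_le)
    fix x :: "real^'n" assume x: "x \<in> cube"
    have "f x - g x = (f x - f (\<Phi> x)) + (\<eta> *\<^sub>R f (\<Phi> x) + (- \<theta>) *\<^sub>R L x)"
      using x by (simp add: g_def algebra_simps)
    then have "Nb (f x - g x) \<le> Nb (f x - f (\<Phi> x)) + Nb (\<eta> *\<^sub>R f (\<Phi> x) + (- \<theta>) *\<^sub>R L x)"
      using B.triangle by metis
    moreover have "Nb (\<eta> *\<^sub>R f (\<Phi> x) + (- \<theta>) *\<^sub>R L x) \<le> \<eta> * Nb (f (\<Phi> x)) + \<theta> * Nb (L x)"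
      using B.triangle[of "\<eta> *\<^sub>R f (\<Phi> x)" "(- \<theta>) *\<^sub>R L x"] \<eta> \<theta>
      unfolding B.scaleR by simp
    moreover have "Nb (f x - f (\<Phi> x)) \<le> e / 4"
      using MD[OF assms(2) x \<Phi>_cube[OF x]] \<Phi>(4)[of x] A.minus_commute[of x "\<Phi> x"] by simp
    moreover have "\<eta> * Nb (f (\<Phi> x)) \<le> \<eta> * Bf"
      using Bf(2)[OF \<Phi>_cube[OF x]] \<eta> by (intro mult_left_mono) auto
    moreover have "Nb (L x) \<le> CL * R0"
      using CL(2)[of x] R0(2)[OF x] CL(1) by (meson mult_left_mono less_imp_le order_trans)
    then have "\<theta> * Nb (L x) \<le> \<theta> * (CL * R0)" using \<theta>(1) by (intro mult_left_mono) auto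
    ultimately show "Nb (f x - g x) \<le> e / 4 + e / 4 + e / 5" using \<eta>(3) \<theta>(3) by (simp add: mult.assoc)
  qed
  also have "\<dots> < e" using assms(3) by simp
  finally have dist: "d f g < e" .
  \<comment> \<open>On the ball of this radius \<open>Na x \<le> r\<close>, so \<Phi> vanishes and
    only the constant and the linear term survive.\<close>
  define \<rho> where "\<rho> = min 1 (r / C4)"
  have \<rho>: "\<rho> > 0" "\<rho> \<le> 1" using \<Phi>(1) C4(1) by (auto simp: \<rho>_def)
  have "g x = (1 - \<eta>) *\<^sub>R f 0 + \<theta> *\<^sub>R L x" if "x \<in> cball 0 \<rho>" for x
  proof -
    have x: "norm x \<le> 1" "norm x \<le> r / C4" using that by (auto simp: \<rho>_def)
    have "Na x \<le> r" using C4(2)[of x] x(2) C4(1) by (simp add: field_simps)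
    moreover have "x \<in> cube" using x(1) by (auto simp: cube_def intro: order_trans[OF component_le_norm_cart])
    ultimately show ?thesis using \<Phi>(5) by (simp add: g_def)
  qed
  from stably_positive[OF gM LP(2,3) \<rho> \<theta>(1) this] gM dist show ?thesis using that by blast
qed

theorem residual_positive_measure:
  assumes "CARD('n) \<le> CARD('m)"
  shows "residual_in M d {f \<in> M. 0 < hausdorff_measure CARD('n) (f ` cube)}"
proof -
  \<comment> \<open>Requiring positivity in a whole neighbourhood makes the set open; as it is also
    dense, a constant sequence of open dense sets witnesses residuality.\<close>
  define U where "U = {f \<in> M. \<exists>\<epsilon>>0. \<forall>h\<in>M. d f h < \<epsilon> \<longrightarrow> 0 < hausdorff_measure CARD('n) (h ` cube)}"
  have "open_in_metric M d U"
    unfolding open_in_metric_def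
  proof (intro conjI ballI)
    fix f assume "f \<in> U"
    then obtain \<epsilon> where \<epsilon>: "f \<in> M" "\<epsilon> > 0" "\<And>h. h \<in> M \<Longrightarrow> d f h < \<epsilon> \<Longrightarrow> 0 < hausdorff_measure CARD('n) (h ` cube)"
      by (auto simp: U_def)
    have "g \<in> U" if g: "g \<in> M" "d f g < \<epsilon> / 2" for g
    proof -
      have "0 < hausdorff_measure CARD('n) (h ` cube)" if "h \<in> M" "d g h < \<epsilon> / 2" for h
        using \<epsilon>(3)[OF that(1)] dist_triangle[OF \<epsilon>(1) g(1) that(1)] g(2) that(2) by linarith
      then show ?thesis using g(1) \<epsilon>(2) unfolding U_def by (auto intro!: exI[of _ "\<epsilon> / 2"])
    qed
    then show "\<exists>e>0. \<forall>g\<in>M. d f g < e \<longrightarrow> g \<in> U" using \<epsilon>(2) by (intro exI[of _ "\<epsilon> / 2"]) auto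
  qed (auto simp: U_def)
  moreover have "dense_in_metric M d U"
    unfolding dense_in_metric_def
  proof (intro conjI ballI allI impI)
    fix f and e :: real assume "f \<in> M" "e > 0"
    from stably_positive_dense[OF assms this] obtain g \<epsilon> where "g \<in> M" "d f g < e" "\<epsilon> > 0"
      "\<And>h. h \<in> M \<Longrightarrow> d g h < \<epsilon> \<Longrightarrow> hausdorff_measure CARD('n) (h ` cube) > 0" by blast
    then show "\<exists>g\<in>U. d f g < e" unfolding U_def by blast
  qed (auto simp: U_def)
  moreover have "U \<subseteq> {f \<in> M. 0 < hausdorff_measure CARD('n) (f ` cube)}"
  proof
    fix f assume f: "f \<in> U"
    then have "f \<in> M" "d f f = 0" by (auto simp: U_def dist_eq_0_iff)
    with f show "f \<in> {f \<in> M. 0 < hausdorff_measure CARD('n) (f ` cube)}" by (auto simp: U_def)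
  qed
  ultimately show ?thesis unfolding residual_in_def by (intro exI[of _ "\<lambda>_. U"]) auto
qed

end


section \<open>Collapsing near a rank-one map\<close>

lemma exists_small_scale:
  fixes a b c \<kappa> \<delta> :: real
  assumes "0 \<le> a" "0 \<le> b" "0 \<le> c" "0 < \<kappa>" "0 < \<delta>"
  obtains s where "0 < s" "s \<le> 1" "s * a \<le> \<kappa>" "s * b \<le> \<kappa>" "s * c \<le> \<delta>"
proof -
  define m K where "m = min 1 (min \<kappa> \<delta>)" and "K = a + b + c + 1"
  have m: "0 < m" "m \<le> 1" "m \<le> \<kappa>" "m \<le> \<delta>" using assms by (auto simp: m_def)
  have "m / K * x \<le> m" if "0 \<le> x" "x \<le> K" for x
  proof -
    have "m / K * x = m * (x / K)" by simp
    also have "\<dots> \<le> m * 1" using that m assms by (intro mult_left_mono) (auto simp: K_def divide_le_eq_1)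
    finally show ?thesis by simp
  qed
  from this[of a] this[of b] this[of c] this[of 1] m assms show ?thesis
    by (intro that[of "m / K"]) (auto simp: K_def)
qed

context lip_space
begin

text \<open>The points \<open>y + s r v\<close> are metric midpoints of \<open>y - s u\<close> and \<open>y + s u\<close>. If these two are
  mapped almost isometrically in the direction of \<open>w\<close>, a point of maximal Euclidean length in the
  unit ball of \<open>Nb\<close>, then the parallelogram law leaves little room for the image of a midpoint.\<close>
lemma midpoint_collapse:
  assumes f: "f \<in> M" and w: "w \<noteq> 0" "\<And>x. norm x \<le> norm w * Nb x"
    and uv: "Na (u + v) \<le> 1" "Na (u - v) \<le> 1" and s: "0 < s" and r: "\<bar>r\<bar> \<le> 1" and \<theta>: "0 < \<theta>" "\<theta> \<le> 1"
    and cube: "y - s *\<^sub>R u \<in> cube" "y + s *\<^sub>R u \<in> cube" "y + (s * r) *\<^sub>R v \<in> cube"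
    and far: "2 * s * (1 - \<theta>\<^sup>2) * (norm w)\<^sup>2 \<le> w \<bullet> (f (y + s *\<^sub>R u) - f (y - s *\<^sub>R u))"
  shows "norm (f (y + (s * r) *\<^sub>R v) - (1 / 2) *\<^sub>R (f (y + s *\<^sub>R u) + f (y - s *\<^sub>R u))) \<le> 2 * norm w * (\<theta> * s)"
proof -
  define p q a where "p = f (y - s *\<^sub>R u)" and "q = f (y + s *\<^sub>R u)" and "a = f (y + (s * r) *\<^sub>R v)"
  \<comment> \<open>\<open>m\<close> is half of the chord between the two endpoint images and
    \<open>z\<close> is the deviation from its midpoint, so that \<open>m + z\<close> and
    \<open>m - z\<close> are the two segments joining \<open>a\<close> to the endpoints.\<close>
  define m z where "m = (1 / 2) *\<^sub>R (q - p)" and "z = a - (1 / 2) *\<^sub>R (q + p)"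
  have conv: "Na (u + r *\<^sub>R v) \<le> 1" if "\<bar>r\<bar> \<le> 1" for r
  proof -
    have "u + r *\<^sub>R v = ((1 + r) / 2) *\<^sub>R (u + v) + ((1 - r) / 2) *\<^sub>R (u - v)"
      by (simp add: vec_eq_iff field_simps)
    then have "Na (u + r *\<^sub>R v) \<le> Na (((1 + r) / 2) *\<^sub>R (u + v)) + Na (((1 - r) / 2) *\<^sub>R (u - v))"
      using A.triangle by metis
    also have "\<dots> = (1 + r) / 2 * Na (u + v) + (1 - r) / 2 * Na (u - v)"
      using that unfolding A.scaleR by (simp add: abs_le_iff)
    also have "\<dots> \<le> (1 + r) / 2 * 1 + (1 - r) / 2 * 1"
      using uv that by (intro add_mono mult_left_mono) auto
    finally show ?thesis by (simp add: field_simps)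
  qed
  have "a - p = m + z" "q - a = m - z"
    by (simp_all add: vec_eq_iff m_def z_def field_simps)
  moreover have "Nb (a - p) \<le> s"
  proof -
    have "Nb (a - p) \<le> Na (s *\<^sub>R (u + r *\<^sub>R v))"
      using MD[OF f cube(3,1)] by (simp add: a_def p_def algebra_simps)
    also have "\<dots> \<le> s * 1" using conv[OF r] s unfolding A.scaleR by (intro mult_mono) auto
    finally show ?thesis by simp
  qed
  moreover have "Nb (q - a) \<le> s"
  proof -
    have "Nb (q - a) \<le> Na (s *\<^sub>R (u + (- r) *\<^sub>R v))"
      using MD[OF f cube(2,3)] by (simp add: a_def q_def algebra_simps)
    also have "\<dots> \<le> s * 1" using conv[of "- r"] r s unfolding A.scaleR by (intro mult_mono) auto
    finally show ?thesis by simp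
  qed
  ultimately have "Nb (m + z) \<le> s" "Nb (m - z) \<le> s" by auto
  then have "norm (m + z) \<le> norm w * s" "norm (m - z) \<le> norm w * s"
    using w(2) by (meson mult_left_mono norm_ge_zero order_trans)+
  then have "(norm (m + z))\<^sup>2 \<le> (norm w * s)\<^sup>2" "(norm (m - z))\<^sup>2 \<le> (norm w * s)\<^sup>2"
    by (auto intro: power_mono)
  moreover have "(norm (m + z))\<^sup>2 + (norm (m - z))\<^sup>2 = 2 * (norm m)\<^sup>2 + 2 * (norm z)\<^sup>2"
    by (simp add: power2_norm_eq_inner algebra_simps inner_commute)
  ultimately have par: "(norm m)\<^sup>2 + (norm z)\<^sup>2 \<le> (norm w * s)\<^sup>2" by linarith
  have "s * (1 - \<theta>\<^sup>2) * (norm w)\<^sup>2 \<le> w \<bullet> m" using far by (simp add: m_def p_def q_def)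
  also have "\<dots> \<le> norm w * norm m" by (rule norm_cauchy_schwarz)
  finally have "norm w * (s * (1 - \<theta>\<^sup>2) * norm w) \<le> norm w * norm m"
    by (simp add: power2_eq_square mult_ac)
  then have "(1 - \<theta>\<^sup>2) * (norm w * s) \<le> norm m" using w(1) by (simp add: mult_ac)
  moreover have "0 \<le> (1 - \<theta>\<^sup>2) * (norm w * s)" using \<theta> s by (simp add: power_le_one)
  ultimately have "((1 - \<theta>\<^sup>2) * (norm w * s))\<^sup>2 \<le> (norm m)\<^sup>2" by (intro power_mono)
  then have "(norm z)\<^sup>2 \<le> (norm w * s)\<^sup>2 - ((1 - \<theta>\<^sup>2) * (norm w * s))\<^sup>2" using par by linarith
  also have "\<dots> = (2 * \<theta>\<^sup>2 - (\<theta>\<^sup>2)\<^sup>2) * (norm w * s)\<^sup>2" by (simp add: power2_eq_square algebra_simps)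
  \<comment> \<open>A relative defect of order \<open>\<theta>\<^sup>2\<close> in the length of
    \<open>m\<close> allows a deviation of order \<theta>.\<close>
  also have "\<dots> \<le> (4 * \<theta>\<^sup>2) * (norm w * s)\<^sup>2"
    using zero_le_power2[of "\<theta>\<^sup>2"] zero_le_power2[of \<theta>] by (intro mult_right_mono zero_le_power2) linarith
  also have "\<dots> = (2 * norm w * (\<theta> * s))\<^sup>2" by (simp add: power_mult_distrib mult_ac)
  finally have "norm z \<le> 2 * norm w * (\<theta> * s)" by (rule power2_le_imp_le) (use \<theta> s in simp)
  then show ?thesis by (simp add: z_def a_def p_def q_def)
qed

text \<open>The cube is split into a boundary layer, a set \<open>E\<close> where \<open>f\<close>
  is far from isometric along \<open>u\<close>, and the rest. The first two have small volume, the
  third has a collapsed direction; each contributes at most \<open>\<Delta> / 3\<close>.\<close>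

lemma small_measure_near_rank_one_map:
  assumes u: "Na u = 1" and v: "v \<noteq> 0" "Na (u + v) \<le> 1" "Na (u - v) \<le> 1" and "\<Delta> > 0"
  obtains f0 \<epsilon> where "f0 \<in> M" "\<epsilon> > 0"
    "\<And>f. f \<in> M \<Longrightarrow> d f0 f < \<epsilon> \<Longrightarrow> hausdorff_measure CARD('n) (f ` cube) \<le> ennreal \<Delta>"
proof -
  let ?n = "CARD('n)"
  obtain \<phi> where \<phi>: "\<phi> \<bullet> u = 1" "\<And>x. \<bar>\<phi> \<bullet> x\<bar> \<le> Na x" using A.support_functional[OF u] by blast
  obtain w where w: "w \<noteq> 0" "Nb w \<le> 1" "\<And>x. norm x \<le> norm w * Nb x" using B.max_norm_point by blast
  obtain j where j: "v $ j \<noteq> 0" using v(1) by (metis vec_eq_iff zero_index)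
  obtain L where L: "L > 0"
    "\<And>f x y. f \<in> M \<Longrightarrow> x \<in> cube \<Longrightarrow> y \<in> cube \<Longrightarrow> norm (f x - f y) \<le> L * norm (x - y)"
    using M_norm_lipschitz by blast
  \<comment> \<open>A norming functional for \<open>w\<close>: it has the value 1 there, and the
    maximality of \<open>norm w\<close> makes it dominated by \<open>Nb\<close>.\<close>
  define \<psi> where "\<psi> z = w \<bullet> z / (norm w)\<^sup>2" for z
  have \<psi>: "\<bar>\<psi> z\<bar> \<le> Nb z" for z
  proof -
    have "\<bar>w \<bullet> z\<bar> \<le> norm w * (norm w * Nb z)"
      using Cauchy_Schwarz_ineq2[of w z] w(3)[of z] by (meson mult_left_mono norm_ge_zero order_trans)
    then show ?thesis using w(1) by (simp add: \<psi>_def power2_eq_square field_simps)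
  qed
  have \<psi>w: "\<psi> (c *\<^sub>R w) = c" for c using w(1) by (simp add: \<psi>_def power2_norm_eq_inner)
  have \<psi>_diff: "\<psi> (x - y) = \<psi> x - \<psi> y" for x y by (simp add: \<psi>_def inner_diff_right diff_divide_distrib)
  define f0 where "f0 x = (if x \<in> cube then (\<phi> \<bullet> x) *\<^sub>R w else 0)" for x
  have f0M: "f0 \<in> M"
  proof (rule MI)
    fix x y :: "real^'n" assume xy: "x \<in> cube" "y \<in> cube"
    then have "f0 x - f0 y = (\<phi> \<bullet> (x - y)) *\<^sub>R w" by (simp add: f0_def inner_diff_right algebra_simps)
    then have "Nb (f0 x - f0 y) = \<bar>\<phi> \<bullet> (x - y)\<bar> * Nb w" by (simp add: B.scaleR)
    also have "\<dots> \<le> Na (x - y) * 1" using \<phi>(2) w(2) by (intro mult_mono) auto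
    finally show "Nb (f0 x - f0 y) \<le> Na (x - y)" by simp
  qed (simp add: f0_def)
  define A where "A = unit_ball_vol ?n * (L * ?n / 2) ^ ?n"
  define c2 where "c2 = 2 ^ ?n * real ?n"
  \<comment> \<open>Twice the constant of \<open>midpoint_collapse\<close>, since two points are
    each compared with the same midpoint.\<close>
  define W where "W = 4 * norm w"
  define D where "D = 4 / \<bar>v $ j\<bar> * 8 ^ (?n - 1) * unit_ball_vol ?n * ((W + L * ?n) / 2) ^ ?n"
  have pos: "A \<ge> 0" "c2 \<ge> 0" "D \<ge> 0" "W \<ge> 0" using L(1) by (auto simp: A_def c2_def D_def W_def)
  have small: "a * (min 1 (\<Delta> / (3 * (a + 1)))) \<le> \<Delta> / 3" if "a \<ge> 0" for a
  proof -
    have "a * (min 1 (\<Delta> / (3 * (a + 1)))) \<le> a * (\<Delta> / (3 * (a + 1)))" using that by (intro mult_left_mono) auto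
    also have "\<dots> \<le> \<Delta> / 3" using that \<open>\<Delta> > 0\<close> by (simp add: field_simps)
    finally show ?thesis .
  qed
  \<comment> \<open>\<kappa> is the thickness of the boundary layer. The halving gives
    \<open>\<kappa> \<le> 1 / 2\<close>, so shifts of length at most \<kappa> do not exceed the half
    side \<open>1 - \<kappa>\<close> of the inner cube.\<close>
  define \<kappa> where "\<kappa> = min 1 (\<Delta> / (3 * (A * c2 + 1))) / 2"
  have "A * c2 * (2 * \<kappa>) \<le> \<Delta> / 3" unfolding \<kappa>_def using small[of "A * c2"] pos by simp
  moreover have \<kappa>: "0 < \<kappa>" "\<kappa> \<le> 1 / 2" using \<open>\<Delta> > 0\<close> pos by (auto simp: \<kappa>_def add_nonneg_pos)
  then have "0 \<le> A * c2 * \<kappa>" using pos by simp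
  ultimately have A\<kappa>: "A * (c2 * \<kappa>) \<le> \<Delta> / 3" by (simp add: mult.assoc)
  define \<theta> where "\<theta> = min 1 (\<Delta> / (3 * (D + 1)))"
  have \<theta>: "0 < \<theta>" "\<theta> \<le> 1" "D * \<theta> \<le> \<Delta> / 3"
    using \<open>\<Delta> > 0\<close> pos small[of D] by (auto simp: \<theta>_def add_nonneg_pos)
  \<comment> \<open>The factor \<open>\<theta>\<^sup>2\<close> compensates the threshold that
    defines \<open>E\<close>. No scale enters, so one neighbourhood of \<open>f0\<close> serves for
    every \<delta>.\<close>
  define \<epsilon> where "\<epsilon> = \<theta>\<^sup>2 * min 1 (\<Delta> / (3 * (A * c2 * norm u + 1)))"
  have \<epsilon>: "0 < \<epsilon>" "A * (\<epsilon> / \<theta>\<^sup>2 * (c2 * norm u)) \<le> \<Delta> / 3"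
    using \<open>\<Delta> > 0\<close> pos \<theta>(1) small[of "A * c2 * norm u"] by (auto simp: \<epsilon>_def add_nonneg_pos mult_ac)
  show ?thesis
  proof
    show "f0 \<in> M" "\<epsilon> > 0" by fact+
    fix f assume f: "f \<in> M" "d f0 f < \<epsilon>"
    have lip: "norm (f x - f y) \<le> L * norm (x - y)" if "x \<in> ccube 1" "y \<in> ccube 1" for x y
      using L(2)[OF f(1)] that by (simp add: cube_eq_ccube)
    \<comment> \<open>On the cube this is \<psi> of the deviation from \<open>f0\<close>, hence
      small. It cannot increase along \<open>u\<close>, since \<phi> grows at unit speed there while
      \<open>\<psi> (f x)\<close> grows at most that fast.\<close>
    define h where "h x = \<psi> (f x) - \<phi> \<bullet> x" for x
    have h_le: "\<bar>h x\<bar> \<le> \<epsilon>" if "x \<in> ccube 1" for x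
    proof -
      have x: "x \<in> cube" using that by (simp add: cube_eq_ccube)
      then have "h x = \<psi> (f x - f0 x)" using \<psi>w by (simp add: h_def \<psi>_diff f0_def)
      then have "\<bar>h x\<bar> \<le> Nb (f x - f0 x)" using \<psi> by simp
      then show ?thesis using dist_ge[OF f0M f(1) x] f(2) B.minus_commute[of "f x" "f0 x"] by linarith
    qed
    have h_cont: "continuous_on (ccube 1) h"
      unfolding h_def \<psi>_def using M_continuous[OF f(1)] w(1)
      by (intro continuous_intros) (auto simp: cube_eq_ccube)
    have pre: "hausdorff_pre ?n \<delta> (f ` cube) \<le> ennreal \<Delta>" if "\<delta> > 0" for \<delta>
    proof -
      \<comment> \<open>Only the scale \<open>s\<close> depends on \<delta>. Shifts by
        \<open>s *\<^sub>R u\<close> and \<open>s *\<^sub>R v\<close> then stay within the layer,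
        and the pieces covering the collapsed part get images of diameter at most \<delta>.\<close>
      obtain s where s: "0 < s" "s \<le> 1" "s * norm u \<le> \<kappa>" "s * norm v \<le> \<kappa>" "s * ((W + L * ?n) * \<theta>) \<le> \<delta>"
        using exists_small_scale[of "norm u" "norm v" "(W + L * ?n) * \<theta>" \<kappa> \<delta>] pos L(1) \<theta>(1) \<kappa> \<open>\<delta> > 0\<close> by auto
      define l c where "l = 1 - \<kappa>" and "c = s *\<^sub>R u"
      have c: "norm c = s * norm u" "norm c \<le> l" "l + norm c \<le> 1" using s(1,3) \<kappa> by (auto simp: c_def l_def)
      let ?Q = "ccube l :: (real^'n) set"
      have near: "y + b \<in> ccube 1" if "y \<in> ?Q" "norm b \<le> \<kappa>" for y b
        using ccube_add[OF that] by (simp add: l_def)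
      have yc: "y + c \<in> ccube 1" "y - c \<in> ccube 1" if "y \<in> ?Q" for y
        using near[OF that, of c] near[OF that, of "- c"] c s(3) by auto
      have h_diff: "h (y - c) - h (y + c) = 2 * s - \<psi> (f (y + c) - f (y - c))" for y
        using \<phi>(1) by (simp add: h_def \<psi>_diff inner_diff_right inner_add_right c_def)
      have mono: "h (y + c) \<le> h (y - c)" if "y \<in> ?Q" for y
      proof -
        have "\<psi> (f (y + c) - f (y - c)) \<le> Na ((y + c) - (y - c))"
          using \<psi>[of "f (y + c) - f (y - c)"] MD[OF f(1), of "y + c" "y - c"] yc[OF that] by (auto simp: cube_eq_ccube)
        also have "(y + c) - (y - c) = (2 * s) *\<^sub>R u" by (simp add: vec_eq_iff c_def)
        finally show ?thesis using h_diff[of y] u s(1) by (simp add: A.scaleR)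
      qed
      define E where "E = {y \<in> ?Q. 2 * s * \<theta>\<^sup>2 < h (y - c) - h (y + c)}"
      have E: "E \<in> lmeasurable" "2 * s * \<theta>\<^sup>2 * measure lebesgue E \<le> 2 * \<epsilon> * (2 ^ ?n * real ?n * norm c)"
        unfolding E_def using measure_translate_diff_le[OF h_cont h_le c(2,3) _ mono, of "2 * s * \<theta>\<^sup>2"] s(1) \<theta>(1) by auto
      have H_E: "hausdorff_pre ?n \<delta> (f ` E) \<le> ennreal (\<Delta> / 3)"
      proof -
        have "E \<subseteq> ?Q" by (auto simp: E_def)
        moreover have "?Q \<subseteq> ccube 1" using \<kappa> near[of _ 0] by auto
        ultimately have sub: "E \<subseteq> ccube 1" by blast
        have "hausdorff_pre ?n \<delta> (f ` E) \<le> ennreal (A * measure lebesgue E)"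
          using hausdorff_pre_lipschitz_image_le[of E L \<delta> f] E(1) L(1) \<open>\<delta> > 0\<close> lip sub bounded_subset[OF bounded_cbox sub]
          by (simp add: A_def subset_iff)
        \<comment> \<open>The factor \<open>s\<close> in \<open>norm c\<close> cancels against the
          threshold, so the bound for the volume of \<open>E\<close> is the same at every
          scale.\<close>
        also have "2 * s * (\<theta>\<^sup>2 * measure lebesgue E) \<le> 2 * s * (\<epsilon> * (c2 * norm u))"
          using E(2) by (simp add: c(1) c2_def mult_ac)
        then have "measure lebesgue E \<le> \<epsilon> / \<theta>\<^sup>2 * (c2 * norm u)" using s(1) \<theta>(1) by (simp add: field_simps)
        then have "A * measure lebesgue E \<le> \<Delta> / 3" using \<epsilon>(2) pos(1) by (meson mult_left_mono order_trans)
        finally show ?thesis by (simp add: ennreal_leI)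
      qed
      have H_layer: "hausdorff_pre ?n \<delta> (f ` (cube - ?Q)) \<le> ennreal (\<Delta> / 3)"
      proof -
        have "?Q \<subseteq> ccube 1" using \<kappa> near[of _ 0] by auto
        have "hausdorff_pre ?n \<delta> (f ` (ccube 1 - ?Q)) \<le> ennreal (A * measure lebesgue (ccube 1 - ?Q))"
          using hausdorff_pre_lipschitz_image_le[of "ccube 1 - ?Q" L \<delta> f] L(1) \<open>\<delta> > 0\<close> lip
          by (simp add: A_def fmeasurable.Diff bounded_diff)
        also have "measure lebesgue (ccube 1 - ?Q) = measure lebesgue (ccube 1 :: (real^'n) set) - measure lebesgue ?Q"
          using \<open>?Q \<subseteq> ccube 1\<close> by (intro measurable_measure_Diff) auto
        also have "measure lebesgue (ccube 1 :: (real^'n) set) - measure lebesgue ?Q \<le> c2 * \<kappa>" unfolding l_def c2_def using \<kappa> by (intro measure_ccube_diff_le) auto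
        then have "A * (measure lebesgue (ccube 1 :: (real^'n) set) - measure lebesgue ?Q) \<le> \<Delta> / 3"
          using A\<kappa> pos(1) by (meson mult_left_mono order_trans)
        finally show ?thesis by (simp add: ennreal_leI cube_eq_ccube)
      qed
      have H_good: "hausdorff_pre ?n \<delta> (f ` (?Q - E)) \<le> ennreal (\<Delta> / 3)"
      proof -
        have srv: "y + (s * r) *\<^sub>R v \<in> ccube 1" if "y \<in> ?Q" "\<bar>r\<bar> \<le> 1" for y r
        proof (rule near[OF that(1)])
          have "norm ((s * r) *\<^sub>R v) = \<bar>r\<bar> * (s * norm v)" using s(1) by (simp add: abs_mult)
          also have "\<dots> \<le> 1 * (s * norm v)" using that(2) s(1) by (intro mult_right_mono) auto
          finally show "norm ((s * r) *\<^sub>R v) \<le> \<kappa>" using s(4) by simp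
        qed
        have mid: "norm (f (y + (s * r) *\<^sub>R v) - (1 / 2) *\<^sub>R (f (y + s *\<^sub>R u) + f (y - s *\<^sub>R u))) \<le> 2 * norm w * (\<theta> * s)"
          if "y \<in> ?Q - E" "\<bar>r\<bar> \<le> 1" for y r
        proof (rule midpoint_collapse[OF f(1) w(1,3) v(2,3) s(1) that(2) \<theta>(1,2)])
          show "y - s *\<^sub>R u \<in> cube" "y + s *\<^sub>R u \<in> cube" "y + (s * r) *\<^sub>R v \<in> cube"
            using that yc srv unfolding cube_eq_ccube c_def by auto
          have "2 * s * (1 - \<theta>\<^sup>2) \<le> \<psi> (f (y + c) - f (y - c))"
            using that(1) h_diff[of y] unfolding E_def right_diff_distrib by auto
          then show "2 * s * (1 - \<theta>\<^sup>2) * (norm w)\<^sup>2 \<le> w \<bullet> (f (y + s *\<^sub>R u) - f (y - s *\<^sub>R u))"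
            using w(1) by (simp add: \<psi>_def c_def field_simps)
        qed
        have "hausdorff_pre ?n \<delta> (f ` (?Q - E)) \<le> ennreal (D * \<theta>)"
          unfolding D_def
        proof (rule hausdorff_pre_collapsed_direction_le[where s = s])
          show "?Q - E \<subseteq> ccube 1" using \<kappa> near[of _ 0] by auto
          show "s * norm v \<le> 1" using s(4) \<kappa> by simp
          show "(W + L * ?n) * (\<theta> * s) \<le> \<delta>" using s(5) by (simp add: mult_ac)
          show "y + (s * r) *\<^sub>R v \<in> ccube 1" if "y \<in> ?Q - E" "\<bar>r\<bar> \<le> 1" for y r using srv that by blast
          show "norm (f (y + (s * r) *\<^sub>R v) - f y) \<le> W * (\<theta> * s)" if "y \<in> ?Q - E" "\<bar>r\<bar> \<le> 1" for y r
            using norm_triangle_ineq4[of "f (y + (s * r) *\<^sub>R v) - (1 / 2) *\<^sub>R (f (y + s *\<^sub>R u) + f (y - s *\<^sub>R u))"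
                "f y - (1 / 2) *\<^sub>R (f (y + s *\<^sub>R u) + f (y - s *\<^sub>R u))"] mid[OF that] mid[OF that(1), of 0]
            by (simp add: W_def)
        qed (use j s \<theta> L(1) pos lip in auto)
        also have "\<dots> \<le> ennreal (\<Delta> / 3)" using \<theta>(3) by (rule ennreal_leI)
        finally show ?thesis .
      qed
      have "f ` cube \<subseteq> f ` (cube - ?Q) \<union> (f ` E \<union> f ` (?Q - E))" by auto
      then have "hausdorff_pre ?n \<delta> (f ` cube) \<le> hausdorff_pre ?n \<delta> (f ` (cube - ?Q) \<union> (f ` E \<union> f ` (?Q - E)))"
        by (rule hausdorff_pre_mono)
      also have "\<dots> \<le> hausdorff_pre ?n \<delta> (f ` (cube - ?Q)) + (hausdorff_pre ?n \<delta> (f ` E) + hausdorff_pre ?n \<delta> (f ` (?Q - E)))"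
        by (intro order_trans[OF hausdorff_pre_Un] add_left_mono hausdorff_pre_Un)
      also have "\<dots> \<le> ennreal (\<Delta> / 3) + (ennreal (\<Delta> / 3) + ennreal (\<Delta> / 3))"
        by (intro add_mono H_E H_layer H_good)
      also have "\<dots> = ennreal \<Delta>" using \<open>\<Delta> > 0\<close> by (simp add: ennreal_plus[symmetric] del: ennreal_plus)
      finally show ?thesis .
    qed
    then show "hausdorff_measure ?n (f ` cube) \<le> ennreal \<Delta>"
      unfolding hausdorff_measure_def by (intro SUP_least) auto
  qed
qed

end

section \<open>The equivalence, from genericity for \<Delta> = 0 and Baire's theorem for \<Delta> >
  0\<close>

theorem theorem1p2:
  fixes Na :: "real^'n \<Rightarrow> real" and Nb :: "real^'m \<Rightarrow> real" and \<Delta> :: real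
  assumes "is_norm Na"
    and "\<exists>u \<in> norm_unit_sphere Na. \<not> extremal_point (norm_unit_ball Na) u"
    and "CARD('n) \<le> CARD('m)"
    and "is_norm Nb"
    and "\<Delta> \<ge> 0"
  shows "residual_in (Lip1 cube (\<lambda>x y. Na (x - y)) (\<lambda>x y. Nb (x - y)))
           (sup_dist cube (\<lambda>x y. Nb (x - y)))
           {f \<in> Lip1 cube (\<lambda>x y. Na (x - y)) (\<lambda>x y. Nb (x - y)).
              ennreal \<Delta> < hausdorff_measure CARD('n) (f ` cube)}
         \<longleftrightarrow> \<Delta> = 0"
proof -
  interpret lip_space Na Nb using assms(1,4) by unfold_locales
  show ?thesis
  proof
    assume res: "residual_in M d {f \<in> M. ennreal \<Delta> < hausdorff_measure CARD('n) (f ` cube)}"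
    show "\<Delta> = 0"
    proof (rule ccontr)
      assume "\<Delta> \<noteq> 0"
      then have "\<Delta> > 0" using assms(5) by simp
      obtain u v where u: "Na u = 1" and v: "v \<noteq> 0" "Na (u + v) \<le> 1" "Na (u - v) \<le> 1"
        using assms(2) by (auto simp: extremal_point_def norm_unit_ball_def norm_unit_sphere_def)
      obtain f0 \<epsilon> where f0: "f0 \<in> M" "\<epsilon> > 0"
        "\<And>f. f \<in> M \<Longrightarrow> d f0 f < \<epsilon> \<Longrightarrow> hausdorff_measure CARD('n) (f ` cube) \<le> ennreal \<Delta>"
        using small_measure_near_rank_one_map[OF u v \<open>\<Delta> > 0\<close>] by blast
      obtain g where "g \<in> M" "ennreal \<Delta> < hausdorff_measure CARD('n) (g ` cube)" "d f0 g < \<epsilon>"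
        using residual_meets_ball[OF res f0(1,2)] by blast
      with f0(3)[of g] show False by simp
    qed
  next
    assume "\<Delta> = 0"
    then show "residual_in M d {f \<in> M. ennreal \<Delta> < hausdorff_measure CARD('n) (f ` cube)}"
      using residual_positive_measure[OF assms(3)] by simp
  qed
qed

end
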